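(* Let $G$ be a finite group with a ramification data $\mathfrak{r}=\sum_{C\in\mathcal{C}}\mathfrak{r}_C C\neq 0$ and let $K$ be an arbitrary field. Then the following statements are equivalent: (1) $L_K(\Gamma_{G,\mathfrak{r}})$ is purely infinite simple; (2) $L_K(\Gamma_{G,\mathfrak{r}})$ is simple; (3) $S_{G,\mathfrak{r}}=G$ and $\sum_{C\in\mathcal{C}}\mathfrak{r}_C|C|\ge 2$.
   Context: Leavitt path algebra. A (directed) graph $E=(E^0,E^1,r,s)$ consists of disjoint sets $E^0$ (vertices) and $E^1$ (edges) and maps $r,s:E^1\to E^0$ (range, source). For a field $K$, $L_K(E)$ is the (not necessarily unital) associative $K$-algebra generated by $E^0\cup E^1\cup\{e^*: e\in E^1\}$ subject to, for all $v,w\in E^0$ and $e,f\in E^1$: (i) $vw=\delta_{v,w}w$; (ii) $s(e)e=e=e\,r(e)$ and $r(e)e^*=e^*=e^*s(e)$; (iii) $e^*f=\delta_{e,f}r(e)$; (iv) $v=\sum_{e\in s^{-1}(v)}ee^*$ for every vertex $v$ with $0<|s^{-1}(v)|<\infty$. Hopf graphs. Let $G$ be a group and $\mathcal{C}$ its set of conjugacy classes. A ramification data of $G$ is a function $\mathfrak{r}:\mathcal{C}\to\mathbb{N}=\{0,1,2,\dots\}$, written $\mathfrak{r}=\sum_{C\in\mathcal{C}}\mathfrak{r}_C C$ with $\mathfrak{r}_C=\mathfrak{r}(C)$; $\mathrm{supp}(\mathfrak{r})=\{C:\mathfrak{r}_C>0\}$. The Hopf graph $\Gamma_{G,\mathfrak{r}}$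 has vertex set $G$ and, for each $x\in G$, $C\in\mathcal{C}$ and $c\in C$, exactly $\mathfrak{r}_C$ edges from $x$ to $xc$. $S_{G,\mathfrak{r}}$ is the subsemigroup of $G$ generated by $\bigcup_{C\in\mathrm{supp}(\mathfrak{r})}C$. Purely infinite simple. An idempotent $e$ in a ring $R$ is infinite if $eR$ is isomorphic, as a right $R$-module, to a proper direct summand of itself. $R$ is purely infinite if every nonzero right ideal of $R$ contains an infinite idempotent. $R$ is purely infinite simple if it is both purely infinite and simple. *)

theory Defs
  imports "HOL-Algebra.Ideal" "HOL-Algebra.Module" "Graph_Theory.Digraph"
begin

section \<open>Associative algebras given by generators and relations\<close>

text \<open>
  The algebra generated by \<open>S\<close> subject to a set of relations is the quotient of the set of
  formal expressions over \<open>S\<close> with scalars in \<open>K\<close> by the least congruence that contains the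
  relations and the axioms of an associative, not necessarily unital, \<open>K\<close>-algebra.
\<close>

datatype ('k, 'x) alg_term =
    Gen 'x
  | Zero
  | Neg "('k, 'x) alg_term"
  | Plus "('k, 'x) alg_term" "('k, 'x) alg_term"
  | Times "('k, 'x) alg_term" "('k, 'x) alg_term"
  | Scale 'k "('k, 'x) alg_term"

definition Sum_list :: "('k, 'x) alg_term list \<Rightarrow> ('k, 'x) alg_term" where
  "Sum_list ts = foldr Plus ts Zero"

inductive_set alg_terms :: "('k, 'b) ring_scheme \<Rightarrow> 'x set \<Rightarrow> ('k, 'x) alg_term set"
  for K :: "('k, 'b) ring_scheme" and S :: "'x set" where
  "x \<in> S \<Longrightarrow> Gen x \<in> alg_terms K S"
| "Zero \<in> alg_terms K S"
| "t \<in> alg_terms K S \<Longrightarrow> Neg t \<in> alg_terms K S"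
| "t \<in> alg_terms K S \<Longrightarrow> u \<in> alg_terms K S \<Longrightarrow> Plus t u \<in> alg_terms K S"
| "t \<in> alg_terms K S \<Longrightarrow> u \<in> alg_terms K S \<Longrightarrow> Times t u \<in> alg_terms K S"
| "a \<in> carrier K \<Longrightarrow> t \<in> alg_terms K S \<Longrightarrow> Scale a t \<in> alg_terms K S"

inductive alg_eq ::
  "('k, 'b) ring_scheme \<Rightarrow> 'x set \<Rightarrow> (('k, 'x) alg_term \<times> ('k, 'x) alg_term) set \<Rightarrow>
    ('k, 'x) alg_term \<Rightarrow> ('k, 'x) alg_term \<Rightarrow> bool"
  for K :: "('k, 'b) ring_scheme" and S :: "'x set"
    and Rel :: "(('k, 'x) alg_term \<times> ('k, 'x) alg_term) set" where
  rel: "(t, u) \<in> Rel \<Longrightarrow> alg_eq K S Rel t u"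
| refl: "t \<in> alg_terms K S \<Longrightarrow> alg_eq K S Rel t t"
| sym: "alg_eq K S Rel t u \<Longrightarrow> alg_eq K S Rel u t"
| trans: "alg_eq K S Rel t u \<Longrightarrow> alg_eq K S Rel u v \<Longrightarrow> alg_eq K S Rel t v"
| Neg_cong: "alg_eq K S Rel t t' \<Longrightarrow> alg_eq K S Rel (Neg t) (Neg t')"
| Plus_cong: "alg_eq K S Rel t t' \<Longrightarrow> alg_eq K S Rel u u' \<Longrightarrow>
    alg_eq K S Rel (Plus t u) (Plus t' u')"
| Times_cong: "alg_eq K S Rel t t' \<Longrightarrow> alg_eq K S Rel u u' \<Longrightarrow>
    alg_eq K S Rel (Times t u) (Times t' u')"
| Scale_cong: "a \<in> carrier K \<Longrightarrow> alg_eq K S Rel t t' \<Longrightarrow>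
    alg_eq K S Rel (Scale a t) (Scale a t')"
| Plus_assoc: "t \<in> alg_terms K S \<Longrightarrow> u \<in> alg_terms K S \<Longrightarrow> v \<in> alg_terms K S \<Longrightarrow>
    alg_eq K S Rel (Plus (Plus t u) v) (Plus t (Plus u v))"
| Plus_comm: "t \<in> alg_terms K S \<Longrightarrow> u \<in> alg_terms K S \<Longrightarrow>
    alg_eq K S Rel (Plus t u) (Plus u t)"
| Plus_Zero: "t \<in> alg_terms K S \<Longrightarrow> alg_eq K S Rel (Plus t Zero) t"
| Plus_Neg: "t \<in> alg_terms K S \<Longrightarrow> alg_eq K S Rel (Plus t (Neg t)) Zero"
| Times_assoc: "t \<in> alg_terms K S \<Longrightarrow> u \<in> alg_terms K S \<Longrightarrow> v \<in> alg_terms K S \<Longrightarrow>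
    alg_eq K S Rel (Times (Times t u) v) (Times t (Times u v))"
| Times_Plus: "t \<in> alg_terms K S \<Longrightarrow> u \<in> alg_terms K S \<Longrightarrow> v \<in> alg_terms K S \<Longrightarrow>
    alg_eq K S Rel (Times t (Plus u v)) (Plus (Times t u) (Times t v))"
| Plus_Times: "t \<in> alg_terms K S \<Longrightarrow> u \<in> alg_terms K S \<Longrightarrow> v \<in> alg_terms K S \<Longrightarrow>
    alg_eq K S Rel (Times (Plus t u) v) (Plus (Times t v) (Times u v))"
| Scale_Plus: "a \<in> carrier K \<Longrightarrow> t \<in> alg_terms K S \<Longrightarrow> u \<in> alg_terms K S \<Longrightarrow>
    alg_eq K S Rel (Scale a (Plus t u)) (Plus (Scale a t) (Scale a u))"
| Scale_add: "a \<in> carrier K \<Longrightarrow> b \<in> carrier K \<Longrightarrow> t \<in> alg_terms K S \<Longrightarrow>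
    alg_eq K S Rel (Scale (a \<oplus>\<^bsub>K\<^esub> b) t) (Plus (Scale a t) (Scale b t))"
| Scale_mult: "a \<in> carrier K \<Longrightarrow> b \<in> carrier K \<Longrightarrow> t \<in> alg_terms K S \<Longrightarrow>
    alg_eq K S Rel (Scale (a \<otimes>\<^bsub>K\<^esub> b) t) (Scale a (Scale b t))"
| Scale_one: "t \<in> alg_terms K S \<Longrightarrow> alg_eq K S Rel (Scale \<one>\<^bsub>K\<^esub> t) t"
| Scale_Times_left: "a \<in> carrier K \<Longrightarrow> t \<in> alg_terms K S \<Longrightarrow> u \<in> alg_terms K S \<Longrightarrow>
    alg_eq K S Rel (Times (Scale a t) u) (Scale a (Times t u))"
| Scale_Times_right: "a \<in> carrier K \<Longrightarrow> t \<in> alg_terms K S \<Longrightarrow> u \<in> alg_terms K S \<Longrightarrow>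
    alg_eq K S Rel (Times t (Scale a u)) (Scale a (Times t u))"

definition alg_rel ::
  "('k, 'b) ring_scheme \<Rightarrow> 'x set \<Rightarrow> (('k, 'x) alg_term \<times> ('k, 'x) alg_term) set \<Rightarrow>
    (('k, 'x) alg_term \<times> ('k, 'x) alg_term) set" where
  "alg_rel K S Rel = {(t, u). alg_eq K S Rel t u}"

definition presented_mult ::
  "('k, 'b) ring_scheme \<Rightarrow> 'x set \<Rightarrow> (('k, 'x) alg_term \<times> ('k, 'x) alg_term) set \<Rightarrow>
    ('k, 'x) alg_term set \<Rightarrow> ('k, 'x) alg_term set \<Rightarrow> ('k, 'x) alg_term set" where
  "presented_mult K S Rel A B = (\<Union>t\<in>A. \<Union>u\<in>B. alg_rel K S Rel `` {Times t u})"

text \<open>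
  The algebra need not have a unit. The field \<open>one\<close> of the record is the two-sided identity
  when there is one, and is unspecified otherwise.
\<close>

definition presented_algebra ::
  "('k, 'b) ring_scheme \<Rightarrow> 'x set \<Rightarrow> (('k, 'x) alg_term \<times> ('k, 'x) alg_term) set \<Rightarrow>
    ('k, ('k, 'x) alg_term set) module" where
  "presented_algebra K S Rel =
    \<lparr> carrier = alg_terms K S // alg_rel K S Rel,
      mult = presented_mult K S Rel,
      one = (THE A. A \<in> alg_terms K S // alg_rel K S Rel \<and>
              (\<forall>B \<in> alg_terms K S // alg_rel K S Rel.
                presented_mult K S Rel A B = B \<and> presented_mult K S Rel B A = B)),
      zero = alg_rel K S Rel `` {Zero},
      add = (\<lambda>A B. \<Union>t\<in>A. \<Union>u\<in>B. alg_rel K S Rel `` {Plus t u}),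
      smult = (\<lambda>a A. \<Union>t\<in>A. alg_rel K S Rel `` {Scale a t}) \<rparr>"


section \<open>Leavitt path algebras\<close>

text \<open>
  A graph is a directed multigraph: \<^const>\<open>tail\<close> is the source map and \<^const>\<open>head\<close> the
  range map.
\<close>

datatype ('v, 'e) leavitt_gen = Vertex 'v | Edge 'e | Ghost 'e

definition leavitt_gens :: "('v, 'e) pre_digraph \<Rightarrow> ('v, 'e) leavitt_gen set" where
  "leavitt_gens E = Vertex ` verts E \<union> Edge ` arcs E \<union> Ghost ` arcs E"

text \<open>
  The list \<open>es\<close> in the last rule enumerates the edges starting at \<open>v\<close>, so that the rule
  applies exactly to the vertices emitting a nonzero finite number of edges.
\<close>

inductive_set leavitt_rels ::
  "('v, 'e) pre_digraph \<Rightarrow>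
    (('k, ('v, 'e) leavitt_gen) alg_term \<times> ('k, ('v, 'e) leavitt_gen) alg_term) set"
  for E :: "('v, 'e) pre_digraph" where
  vertex_idem: "v \<in> verts E \<Longrightarrow>
    (Times (Gen (Vertex v)) (Gen (Vertex v)), Gen (Vertex v)) \<in> leavitt_rels E"
| vertex_orth: "v \<in> verts E \<Longrightarrow> w \<in> verts E \<Longrightarrow> v \<noteq> w \<Longrightarrow>
    (Times (Gen (Vertex v)) (Gen (Vertex w)), Zero) \<in> leavitt_rels E"
| source_edge: "e \<in> arcs E \<Longrightarrow>
    (Times (Gen (Vertex (tail E e))) (Gen (Edge e)), Gen (Edge e)) \<in> leavitt_rels E"
| edge_range: "e \<in> arcs E \<Longrightarrow>
    (Times (Gen (Edge e)) (Gen (Vertex (head E e))), Gen (Edge e)) \<in> leavitt_rels E"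
| range_ghost: "e \<in> arcs E \<Longrightarrow>
    (Times (Gen (Vertex (head E e))) (Gen (Ghost e)), Gen (Ghost e)) \<in> leavitt_rels E"
| ghost_source: "e \<in> arcs E \<Longrightarrow>
    (Times (Gen (Ghost e)) (Gen (Vertex (tail E e))), Gen (Ghost e)) \<in> leavitt_rels E"
| ghost_edge_same: "e \<in> arcs E \<Longrightarrow>
    (Times (Gen (Ghost e)) (Gen (Edge e)), Gen (Vertex (head E e))) \<in> leavitt_rels E"
| ghost_edge_diff: "e \<in> arcs E \<Longrightarrow> f \<in> arcs E \<Longrightarrow> e \<noteq> f \<Longrightarrow>
    (Times (Gen (Ghost e)) (Gen (Edge f)), Zero) \<in> leavitt_rels E"
| vertex_sum: "v \<in> verts E \<Longrightarrow> es \<noteq> [] \<Longrightarrow> distinct es \<Longrightarrow>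
    set es = out_arcs E v \<Longrightarrow>
    (Gen (Vertex v), Sum_list (map (\<lambda>e. Times (Gen (Edge e)) (Gen (Ghost e))) es))
      \<in> leavitt_rels E"

definition leavitt_path_algebra ::
  "('k, 'b) ring_scheme \<Rightarrow> ('v, 'e) pre_digraph \<Rightarrow>
    ('k, ('k, ('v, 'e) leavitt_gen) alg_term set) module" where
  "leavitt_path_algebra K E = presented_algebra K (leavitt_gens E) (leavitt_rels E)"


section \<open>Simple and purely infinite rings\<close>

text \<open>
  Rings need not have a unit here, so the locales \<^locale>\<open>ring\<close> and \<^locale>\<open>ideal\<close>, which
  presuppose one, are avoided.
\<close>

definition right_ideal :: "'a set \<Rightarrow> ('a, 'm) ring_scheme \<Rightarrow> bool" where
  "right_ideal I R \<longleftrightarrow> additive_subgroup I R \<and> (\<forall>a\<in>I. \<forall>x\<in>carrier R. a \<otimes>\<^bsub>R\<^esub> x \<in> I)"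

definition two_sided_ideal :: "'a set \<Rightarrow> ('a, 'm) ring_scheme \<Rightarrow> bool" where
  "two_sided_ideal I R \<longleftrightarrow> right_ideal I R \<and> (\<forall>a\<in>I. \<forall>x\<in>carrier R. x \<otimes>\<^bsub>R\<^esub> a \<in> I)"

definition simple_ring :: "('a, 'm) ring_scheme \<Rightarrow> bool" where
  "simple_ring R \<longleftrightarrow>
    (\<exists>x\<in>carrier R. \<exists>y\<in>carrier R. x \<otimes>\<^bsub>R\<^esub> y \<noteq> \<zero>\<^bsub>R\<^esub>) \<and>
    (\<forall>I. two_sided_ideal I R \<longrightarrow> I = {\<zero>\<^bsub>R\<^esub>} \<or> I = carrier R)"

text \<open>The right \<open>R\<close>-modules that occur are all right ideals of \<open>R\<close>.\<close>

definition right_ideal_iso ::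
  "('a, 'm) ring_scheme \<Rightarrow> 'a set \<Rightarrow> 'a set \<Rightarrow> bool" where
  "right_ideal_iso R M N \<longleftrightarrow>
    (\<exists>f. bij_betw f M N \<and>
      (\<forall>a\<in>M. \<forall>b\<in>M. f (a \<oplus>\<^bsub>R\<^esub> b) = f a \<oplus>\<^bsub>R\<^esub> f b) \<and>
      (\<forall>a\<in>M. \<forall>x\<in>carrier R. f (a \<otimes>\<^bsub>R\<^esub> x) = f a \<otimes>\<^bsub>R\<^esub> x))"

definition direct_summand :: "('a, 'm) ring_scheme \<Rightarrow> 'a set \<Rightarrow> 'a set \<Rightarrow> bool" where
  "direct_summand R A M \<longleftrightarrow>
    right_ideal A R \<and>
    (\<exists>B. right_ideal B R \<and> A \<inter> B = {\<zero>\<^bsub>R\<^esub>} \<and> A <+>\<^bsub>R\<^esub> B = M)"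

definition infinite_idempotent :: "('a, 'm) ring_scheme \<Rightarrow> 'a \<Rightarrow> bool" where
  "infinite_idempotent R e \<longleftrightarrow>
    e \<in> carrier R \<and> e \<otimes>\<^bsub>R\<^esub> e = e \<and>
    (\<exists>A. direct_summand R A ((\<lambda>x. e \<otimes>\<^bsub>R\<^esub> x) ` carrier R) \<and>
         A \<noteq> (\<lambda>x. e \<otimes>\<^bsub>R\<^esub> x) ` carrier R \<and>
         right_ideal_iso R ((\<lambda>x. e \<otimes>\<^bsub>R\<^esub> x) ` carrier R) A)"

definition purely_infinite :: "('a, 'm) ring_scheme \<Rightarrow> bool" where
  "purely_infinite R \<longleftrightarrow>
    (\<forall>I. right_ideal I R \<and> I \<noteq> {\<zero>\<^bsub>R\<^esub>} \<longrightarrow> (\<exists>e\<in>I. infinite_idempotent R e))"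

definition purely_infinite_simple :: "('a, 'm) ring_scheme \<Rightarrow> bool" where
  "purely_infinite_simple R \<longleftrightarrow> purely_infinite R \<and> simple_ring R"


section \<open>Hopf graphs\<close>

definition conj_class :: "('g, 'm) monoid_scheme \<Rightarrow> 'g \<Rightarrow> 'g set" where
  "conj_class G x = (\<lambda>g. g \<otimes>\<^bsub>G\<^esub> x \<otimes>\<^bsub>G\<^esub> inv\<^bsub>G\<^esub> g) ` carrier G"

definition conj_classes :: "('g, 'm) monoid_scheme \<Rightarrow> 'g set set" where
  "conj_classes G = conj_class G ` carrier G"

text \<open>
  A ramification data is a function \<open>'g set \<Rightarrow> nat\<close> of which only the values on conjugacy
  classes matter.
\<close>

definition ram_support :: "('g, 'm) monoid_scheme \<Rightarrow> ('g set \<Rightarrow> nat) \<Rightarrow> 'g set set" where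
  "ram_support G r = {C \<in> conj_classes G. r C > 0}"

text \<open>The edge \<open>(x, C, c, i)\<close> is the \<open>i\<close>-th of the \<open>r C\<close> edges from \<open>x\<close> to \<open>x c\<close> given by \<open>c \<in> C\<close>.\<close>

definition hopf_graph ::
  "('g, 'm) monoid_scheme \<Rightarrow> ('g set \<Rightarrow> nat) \<Rightarrow> ('g, 'g \<times> 'g set \<times> 'g \<times> nat) pre_digraph" where
  "hopf_graph G r =
    \<lparr> verts = carrier G,
      arcs = {(x, C, c, i). x \<in> carrier G \<and> C \<in> conj_classes G \<and> c \<in> C \<and> i < r C},
      tail = (\<lambda>(x, C, c, i). x),
      head = (\<lambda>(x, C, c, i). x \<otimes>\<^bsub>G\<^esub> c) \<rparr>"

inductive_set subsemigroup_generated :: "('g, 'm) monoid_scheme \<Rightarrow> 'g set \<Rightarrow> 'g set"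
  for G :: "('g, 'm) monoid_scheme" and A :: "'g set" where
  incl: "x \<in> A \<Longrightarrow> x \<in> subsemigroup_generated G A"
| mult: "x \<in> subsemigroup_generated G A \<Longrightarrow> y \<in> subsemigroup_generated G A \<Longrightarrow>
    x \<otimes>\<^bsub>G\<^esub> y \<in> subsemigroup_generated G A"

definition ram_semigroup :: "('g, 'm) monoid_scheme \<Rightarrow> ('g set \<Rightarrow> nat) \<Rightarrow> 'g set" where
  "ram_semigroup G r = subsemigroup_generated G (\<Union> (ram_support G r))"

end

(*
A Leavitt path algebra of a finite graph without sinks is unital, and right multiplication by a
long path turns any element into a combination of real paths. If every vertex emits two edges,
conjugating by suitable edges strips such a combination down to a vertex, so every nonzero a has
x a y = v for some vertex v. Together with strong connectedness this yields simplicity and, since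
v is an infinite idempotent, an infinite idempotent a y x in every right ideal containing a.
Conversely, ideals come from kernels of the representation on functions on infinite paths. If the
semigroup S is not G, then S is a union of components of the Hopf graph, and the representation on
paths inside S has a proper nonzero kernel. If every vertex emits only one edge, then all infinite
paths have period |G|, and a nontrivial relation holds in the ungraded representation but not in
the graded one.
*)
theory Submission
  imports Defs "HOL-Algebra.Multiplicative_Group"
begin

section \<open>Presented algebras\<close>

text \<open>Equality in the algebra is derivability from the relations, so an element can be shown
  to be nonzero only in a model. One family of models serves all such purposes: functions on
  infinite paths, with a vertex set \<open>Q\<close> that confines the paths and a weight
  \<open>d\<close> for the degree. Obstructions to simplicity arise from comparing two members of
  the family: an element that vanishes in one and not in the other spoils simplicity. The sum in the
  third statement is the number of edges leaving each vertex, so the bound 2 provides, for every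
  vertex and every edge \<open>f\<close>, an edge other than \<open>f\<close> that leaves the
  vertex. This drives the reduction: \<open>gho e\<close> kills every path of positive length that
  does not begin with \<open>e\<close>, while conjugating the tail of \<open>e\<close> gives the
  head of \<open>e\<close>. An edge that avoids the first letter of one path therefore removes that
  path and keeps a vertex. The semigroup is a union of components because the subsemigroup of a
  finite group is closed under inverses: an edge from \<open>x\<close> to \<open>x c\<close> can
  enter it only from inside.\<close>

locale presentation = cring K for K :: "('k, 'b) ring_scheme" (structure) +
  fixes S :: "'x set" and Rel :: "(('k, 'x) alg_term \<times> ('k, 'x) alg_term) set"
  assumes Rel_terms: "Rel \<subseteq> alg_terms K S \<times> alg_terms K S"
begin

abbreviation T where "T \<equiv> alg_terms K S"
abbreviation A where "A \<equiv> presented_algebra K S Rel"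

definition cl :: "('k, 'x) alg_term \<Rightarrow> ('k, 'x) alg_term set" where
  "cl t = alg_rel K S Rel `` {t}"

lemma alg_eq_terms: "alg_eq K S Rel t u \<Longrightarrow> t \<in> T \<and> u \<in> T"
  by (induction rule: alg_eq.induct) (use Rel_terms in \<open>auto intro: alg_terms.intros\<close>)

lemma equiv_alg_rel: "equiv T (alg_rel K S Rel)"
  unfolding equiv_def refl_on_def sym_def trans_def alg_rel_def
  using alg_eq_terms by (auto intro: alg_eq.intros)

lemma cl_eq_iff: "t \<in> T \<Longrightarrow> u \<in> T \<Longrightarrow> cl t = cl u \<longleftrightarrow> alg_eq K S Rel t u"
  unfolding cl_def by (subst eq_equiv_class_iff[OF equiv_alg_rel]) (auto simp: alg_rel_def)

lemma cl_eqI: "alg_eq K S Rel t u \<Longrightarrow> cl t = cl u"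
  using cl_eq_iff alg_eq_terms by blast

lemma carrier_eq: "carrier A = cl ` T"
  by (auto simp: presented_algebra_def cl_def quotient_def)

lemma carrierE: assumes "a \<in> carrier A" obtains t where "t \<in> T" "a = cl t"
  using assms carrier_eq by auto

lemma cl_closed: "t \<in> T \<Longrightarrow> cl t \<in> carrier A"
  by (simp add: carrier_eq)

lemma cl_zero: "\<zero>\<^bsub>A\<^esub> = cl Zero"
  by (simp add: presented_algebra_def cl_def)

text \<open>If \<open>f\<close> respects the congruence, all sets in the union are one and the same
  class. This turns the operations of the record, which are unions over representatives, into
  computations with single representatives.\<close>

lemma cl_lift1:
  assumes "t \<in> T" and "\<And>t'. alg_eq K S Rel t t' \<Longrightarrow> alg_eq K S Rel (f t) (f t')"
  shows "(\<Union>t'\<in>cl t. alg_rel K S Rel `` {f t'}) = cl (f t)"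
proof -
  have "alg_rel K S Rel `` {f t'} = cl (f t)" if "t' \<in> cl t" for t'
    using that assms(2) cl_eqI by (fastforce simp: cl_def alg_rel_def)
  moreover have "t \<in> cl t"
    using assms alg_eq.refl by (auto simp: cl_def alg_rel_def)
  ultimately show ?thesis by blast
qed

lemma cl_lift2:
  assumes "t \<in> T" "u \<in> T"
    and "\<And>t' u'. alg_eq K S Rel t t' \<Longrightarrow> alg_eq K S Rel u u' \<Longrightarrow> alg_eq K S Rel (f t u) (f t' u')"
  shows "(\<Union>t'\<in>cl t. \<Union>u'\<in>cl u. alg_rel K S Rel `` {f t' u'}) = cl (f t u)"
proof -
  have "alg_rel K S Rel `` {f t' u'} = cl (f t u)" if "t' \<in> cl t" "u' \<in> cl u" for t' u'
    using that assms(3) cl_eqI by (fastforce simp: cl_def alg_rel_def)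
  moreover have "t \<in> cl t" "u \<in> cl u"
    using assms alg_eq.refl by (auto simp: cl_def alg_rel_def)
  ultimately show ?thesis by blast
qed

lemma cl_add: "t \<in> T \<Longrightarrow> u \<in> T \<Longrightarrow> cl t \<oplus>\<^bsub>A\<^esub> cl u = cl (Plus t u)"
  using cl_lift2[of t u Plus] by (simp add: presented_algebra_def alg_eq.Plus_cong)

lemma cl_mult: "t \<in> T \<Longrightarrow> u \<in> T \<Longrightarrow> cl t \<otimes>\<^bsub>A\<^esub> cl u = cl (Times t u)"
  using cl_lift2[of t u Times]
  by (simp add: presented_algebra_def presented_mult_def alg_eq.Times_cong)

lemma cl_smult: "a \<in> carrier K \<Longrightarrow> t \<in> T \<Longrightarrow> a \<odot>\<^bsub>A\<^esub> cl t = cl (Scale a t)"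
  using cl_lift1[of t "Scale a"] by (simp add: presented_algebra_def alg_eq.Scale_cong)

lemma cl_sum_list: "set ts \<subseteq> T \<Longrightarrow> Sum_list ts \<in> T \<and> cl (Sum_list ts) = foldr (\<oplus>\<^bsub>A\<^esub>) (map cl ts) \<zero>\<^bsub>A\<^esub>"
  by (induction ts) (auto simp: Sum_list_def cl_zero alg_terms.intros cl_add[symmetric])

section \<open>Ring and module structure of the quotient\<close>

lemma abelian_group_A: "abelian_group A"
proof (rule abelian_groupI)
  fix x assume "x \<in> carrier A"
  then obtain t where t: "t \<in> T" "x = cl t" by (rule carrierE)
  have "alg_eq K S Rel (Plus (Neg t) t) Zero"
    by (meson t alg_eq.trans alg_eq.Plus_comm alg_eq.Plus_Neg alg_terms.intros)
  then show "\<exists>y\<in>carrier A. y \<oplus>\<^bsub>A\<^esub> x = \<zero>\<^bsub>A\<^esub>"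
    using t cl_eqI by (intro bexI[of _ "cl (Neg t)"]) (auto simp: cl_zero cl_add cl_closed alg_terms.intros)
  have "alg_eq K S Rel (Plus Zero t) t"
    by (meson t alg_eq.trans alg_eq.Plus_comm alg_eq.Plus_Zero alg_terms.intros)
  then show "\<zero>\<^bsub>A\<^esub> \<oplus>\<^bsub>A\<^esub> x = x"
    using t cl_eqI by (simp add: cl_zero cl_add alg_terms.intros)
qed (auto simp: carrier_eq cl_zero cl_add alg_terms.intros
    intro!: cl_eqI imageI intro: alg_eq.intros del: equalityI)

lemma cl_uminus: "t \<in> T \<Longrightarrow> \<ominus>\<^bsub>A\<^esub> cl t = cl (Neg t)"
proof -
  interpret ab: abelian_group A by (rule abelian_group_A)
  assume t: "t \<in> T"
  then have "cl t \<oplus>\<^bsub>A\<^esub> cl (Neg t) = \<zero>\<^bsub>A\<^esub>"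
    by (auto simp: cl_add cl_zero alg_terms.intros intro!: cl_eqI alg_eq.Plus_Neg del: equalityI)
  then show ?thesis using t by (metis ab.a_comm ab.minus_equality cl_closed alg_terms.intros(3))
qed

lemma A_m_closed:
  "x \<in> carrier A \<Longrightarrow> y \<in> carrier A \<Longrightarrow> x \<otimes>\<^bsub>A\<^esub> y \<in> carrier A"
  by (auto simp: carrier_eq cl_mult intro: alg_terms.intros)

lemma
  assumes "x \<in> carrier A" "y \<in> carrier A" "z \<in> carrier A"
  shows A_l_distr: "(x \<oplus>\<^bsub>A\<^esub> y) \<otimes>\<^bsub>A\<^esub> z = x \<otimes>\<^bsub>A\<^esub> z \<oplus>\<^bsub>A\<^esub> y \<otimes>\<^bsub>A\<^esub> z"
    and A_r_distr: "z \<otimes>\<^bsub>A\<^esub> (x \<oplus>\<^bsub>A\<^esub> y) = z \<otimes>\<^bsub>A\<^esub> x \<oplus>\<^bsub>A\<^esub> z \<otimes>\<^bsub>A\<^esub> y"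
    and A_m_assoc: "x \<otimes>\<^bsub>A\<^esub> y \<otimes>\<^bsub>A\<^esub> z = x \<otimes>\<^bsub>A\<^esub> (y \<otimes>\<^bsub>A\<^esub> z)"
  using assms by (auto simp: carrier_eq cl_mult cl_add alg_terms.intros
      intro!: cl_eqI intro: alg_eq.intros del: equalityI)

text \<open>Distributivity makes the product additively idempotent, and in a group only zero is. The
  argument avoids the locale \<open>ring\<close>, which becomes available only after a unit has been
  found.\<close>

lemma
  assumes "z \<in> carrier A"
  shows A_r_null: "z \<otimes>\<^bsub>A\<^esub> \<zero>\<^bsub>A\<^esub> = \<zero>\<^bsub>A\<^esub>" and A_l_null: "\<zero>\<^bsub>A\<^esub> \<otimes>\<^bsub>A\<^esub> z = \<zero>\<^bsub>A\<^esub>"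
proof -
  interpret ab: abelian_group A by (rule abelian_group_A)
  have "x = \<zero>\<^bsub>A\<^esub>" if "x \<in> carrier A" "x \<oplus>\<^bsub>A\<^esub> x = x" for x
    using that by (metis ab.add.r_cancel_one')
  then show "z \<otimes>\<^bsub>A\<^esub> \<zero>\<^bsub>A\<^esub> = \<zero>\<^bsub>A\<^esub>" "\<zero>\<^bsub>A\<^esub> \<otimes>\<^bsub>A\<^esub> z = \<zero>\<^bsub>A\<^esub>"
    using assms A_m_closed A_l_distr[of "\<zero>\<^bsub>A\<^esub>" "\<zero>\<^bsub>A\<^esub>" z] A_r_distr[of "\<zero>\<^bsub>A\<^esub>" "\<zero>\<^bsub>A\<^esub>" z]
    by auto
qed

text \<open>An element that acts as a unit on the generators is a unit, which makes the unspecified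
  field \<open>one\<close> of the record meaningful.\<close>

lemma ring_A:
  assumes u: "u \<in> T"
    and l: "\<And>x. x \<in> S \<Longrightarrow> alg_eq K S Rel (Times u (Gen x)) (Gen x)"
    and r: "\<And>x. x \<in> S \<Longrightarrow> alg_eq K S Rel (Times (Gen x) u) (Gen x)"
  shows "ring A" and "\<one>\<^bsub>A\<^esub> = cl u"
proof -
  interpret ab: abelian_group A by (rule abelian_group_A)
  have "cl u \<otimes>\<^bsub>A\<^esub> cl t = cl t \<and> cl t \<otimes>\<^bsub>A\<^esub> cl u = cl t" if "t \<in> T" for t
    using that
  proof (induction rule: alg_terms.induct)
    case (1 x)
    then show ?case using l r u by (auto simp: cl_mult alg_terms.intros intro!: cl_eqI del: equalityI)
  next
    case 2
    then show ?case using A_l_null A_r_null u cl_zero cl_closed by auto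
  next
    case (3 t)
    have n: "cl t \<oplus>\<^bsub>A\<^esub> cl (Neg t) = \<zero>\<^bsub>A\<^esub>"
      using 3 by (auto simp: cl_add cl_zero alg_terms.intros intro!: cl_eqI alg_eq.Plus_Neg del: equalityI)
    have uA: "cl u \<in> carrier A" "cl t \<in> carrier A" "cl (Neg t) \<in> carrier A"
      using u 3 by (auto intro: cl_closed alg_terms.intros)
    \<comment> \<open>The product of \<open>Neg t\<close> and \<open>u\<close>, on either side, is
      found by uniqueness of additive inverses: added to \<open>cl t\<close> it gives zero.\<close>
    have canc: "x = cl (Neg t)" if "x \<in> carrier A" "cl t \<oplus>\<^bsub>A\<^esub> x = \<zero>\<^bsub>A\<^esub>" for x
      using that n uA by (metis ab.minus_equality ab.a_comm)
    have "cl t \<oplus>\<^bsub>A\<^esub> cl u \<otimes>\<^bsub>A\<^esub> cl (Neg t) = \<zero>\<^bsub>A\<^esub>" "cl t \<oplus>\<^bsub>A\<^esub> cl (Neg t) \<otimes>\<^bsub>A\<^esub> cl u = \<zero>\<^bsub>A\<^esub>"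
      using A_r_distr[OF uA(2,3,1)] A_l_distr[OF uA(2,3,1)] 3 n A_l_null A_r_null uA by auto
    then show ?case using canc A_m_closed uA by blast
  next
    case (4 t s)
    then show ?case using A_l_distr[of "cl t" "cl s" "cl u"] A_r_distr[of "cl t" "cl s" "cl u"] u
      by (auto simp: cl_add cl_closed)
  next
    case (5 t s)
    then show ?case using A_m_assoc[of "cl u" "cl t" "cl s"] A_m_assoc[of "cl t" "cl s" "cl u"] u
      by (auto simp: cl_mult[symmetric] cl_closed)
  next
    case (6 a t)
    have "cl (Times u (Scale a t)) = cl (Scale a (Times u t))"
      "cl (Times (Scale a t) u) = cl (Scale a (Times t u))"
      using 6 u by (auto intro!: cl_eqI intro: alg_eq.intros del: equalityI)
    moreover have "cl (Scale a (Times u t)) = cl (Scale a t)" "cl (Scale a (Times t u)) = cl (Scale a t)"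
      using 6 u by (auto simp: cl_smult[symmetric] cl_mult[symmetric] alg_terms.intros)
    ultimately show ?case using 6 u by (auto simp: cl_mult alg_terms.intros)
  qed
  then have one: "cl u \<otimes>\<^bsub>A\<^esub> x = x" "x \<otimes>\<^bsub>A\<^esub> cl u = x" if "x \<in> carrier A" for x
    using that by (auto simp: carrier_eq)
  have oneA: "\<one>\<^bsub>A\<^esub> = (THE e. e \<in> carrier A \<and>
              (\<forall>x \<in> carrier A. e \<otimes>\<^bsub>A\<^esub> x = x \<and> x \<otimes>\<^bsub>A\<^esub> e = x))"
    by (simp add: presented_algebra_def)
  \<comment> \<open>The definite description in the record has \<open>cl u\<close> as its only
    candidate, since two-sided units are unique.\<close>
  show 1: "\<one>\<^bsub>A\<^esub> = cl u"
    unfolding oneA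
  proof (rule the_equality)
    show "cl u \<in> carrier A \<and> (\<forall>x \<in> carrier A. cl u \<otimes>\<^bsub>A\<^esub> x = x \<and> x \<otimes>\<^bsub>A\<^esub> cl u = x)"
      using one u cl_closed by blast
  next
    fix e assume "e \<in> carrier A \<and> (\<forall>x \<in> carrier A. e \<otimes>\<^bsub>A\<^esub> x = x \<and> x \<otimes>\<^bsub>A\<^esub> e = x)"
    then show "e = cl u" using one u cl_closed by metis
  qed
  show "ring A"
    by (rule ringI) (use 1 u A_m_closed A_l_distr A_r_distr A_m_assoc one abelian_group_A cl_closed in
        \<open>auto intro!: monoid.intro\<close>)
qed

lemma module_A: "Module.module K A"
proof (rule moduleI)
qed (auto simp: abelian_group_A carrier_eq cl_add cl_smult alg_terms.intros is_cring
    intro!: cl_eqI imageI intro: alg_eq.intros del: equalityI)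

lemma smult_mult_A:
  assumes "a \<in> carrier K" "x \<in> carrier A" "y \<in> carrier A"
  shows "(a \<odot>\<^bsub>A\<^esub> x) \<otimes>\<^bsub>A\<^esub> y = a \<odot>\<^bsub>A\<^esub> (x \<otimes>\<^bsub>A\<^esub> y)"
    and "x \<otimes>\<^bsub>A\<^esub> (a \<odot>\<^bsub>A\<^esub> y) = a \<odot>\<^bsub>A\<^esub> (x \<otimes>\<^bsub>A\<^esub> y)"
  using assms by (auto simp: carrier_eq cl_mult cl_smult alg_terms.intros
      intro!: cl_eqI intro: alg_eq.intros del: equalityI)

end

section \<open>Infinite idempotents\<close>

lemma (in ring) right_ideal_principal:
  assumes e: "e \<in> carrier R"
  shows "right_ideal ((\<lambda>x. e \<otimes> x) ` carrier R) R"
proof -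
  have "subgroup ((\<lambda>x. e \<otimes> x) ` carrier R) (add_monoid R)"
  proof (rule add.subgroupI)
    fix a assume "a \<in> (\<lambda>x. e \<otimes> x) ` carrier R"
    then obtain x where "x \<in> carrier R" "a = e \<otimes> x" by auto
    then show "\<ominus> a \<in> (\<lambda>x. e \<otimes> x) ` carrier R"
      using e by (auto simp: r_minus[symmetric] intro!: imageI)
  next
    fix a b assume "a \<in> (\<lambda>x. e \<otimes> x) ` carrier R" "b \<in> (\<lambda>x. e \<otimes> x) ` carrier R"
    then show "a \<oplus> b \<in> (\<lambda>x. e \<otimes> x) ` carrier R"
      using e by (auto simp: r_distr[symmetric] intro!: imageI)
  qed (use e in auto)
  then show ?thesis
    using e by (auto simp: right_ideal_def m_assoc intro!: additive_subgroup.intro)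
qed

text \<open>Since \<open>t \<otimes> s = e\<close>, the product \<open>s \<otimes> t\<close> is an
  idempotent below \<open>e\<close> and equivalent to it. Left multiplication by \<open>s\<close>
  maps \<open>eR\<close> onto \<open>(st)R\<close>, with left multiplication by \<open>t\<close> as
  its inverse, and \<open>(e - st)R\<close> is the complement of \<open>(st)R\<close> in
  \<open>eR\<close>.\<close>

lemma (in ring) infinite_idempotentI:
  assumes c: "e \<in> carrier R" "s \<in> carrier R" "t \<in> carrier R"
    and es: "e \<otimes> s = s" and et: "e \<otimes> t = t" and te: "t \<otimes> e = t"
    and ts: "t \<otimes> s = e" and st: "s \<otimes> t \<noteq> e"
  shows "infinite_idempotent R e"
proof -
  let ?f = "s \<otimes> t" and ?eR = "(\<lambda>x. e \<otimes> x) ` carrier R"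
  let ?A = "(\<lambda>x. ?f \<otimes> x) ` carrier R" and ?B = "(\<lambda>x. (e \<ominus> ?f) \<otimes> x) ` carrier R"
  have ee: "e \<otimes> e = e" using c by (metis et m_assoc ts)
  have ef: "e \<otimes> ?f = ?f" and fe: "?f \<otimes> e = ?f" using c es te by (simp_all add: m_assoc flip: m_assoc[of e])
  have ff: "?f \<otimes> ?f = ?f" using c et ts by (metis m_assoc m_closed)
  have eI: "e \<otimes> x \<in> ?eR" if "x \<in> carrier R" for x using that by auto
  have fsub: "?f \<otimes> x \<in> ?eR" if "x \<in> carrier R" for x
  proof -
    have "?f \<otimes> x = e \<otimes> (?f \<otimes> x)" using that c ef by (simp flip: m_assoc)
    then show ?thesis using that c by (metis eI m_closed)
  qed
  have gsub: "(e \<ominus> ?f) \<otimes> x \<in> ?eR" if "x \<in> carrier R" for x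
  proof -
    have "(e \<ominus> ?f) \<otimes> x = e \<otimes> ((e \<ominus> ?f) \<otimes> x)"
      using that c ef ee by (simp add: m_assoc[symmetric] minus_eq r_distr r_minus)
    then show ?thesis using that c by (metis eI m_closed minus_closed)
  qed
  have eR_sub: "?eR \<subseteq> carrier R" using c by auto
  have fg: "?f \<otimes> (e \<ominus> ?f) = \<zero>"
    using c fe ff by (simp add: minus_eq r_distr r_minus r_neg)
  have int: "?A \<inter> ?B = {\<zero>}"
  proof
    show "?A \<inter> ?B \<subseteq> {\<zero>}"
    proof
      fix z assume "z \<in> ?A \<inter> ?B"
      then obtain x y where x: "x \<in> carrier R" "z = ?f \<otimes> x" and y: "y \<in> carrier R" "z = (e \<ominus> ?f) \<otimes> y"
        by auto
      have "z = ?f \<otimes> z" using x c ff by (simp flip: m_assoc)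
      also have "\<dots> = (?f \<otimes> (e \<ominus> ?f)) \<otimes> y" using y c by (simp add: m_assoc)
      finally show "z \<in> {\<zero>}" using fg y by simp
    qed
    show "{\<zero>} \<subseteq> ?A \<inter> ?B"
      using c by (auto intro!: image_eqI[of _ _ \<zero>])
  qed
  have sum: "?A <+>\<^bsub>R\<^esub> ?B = ?eR"
  proof
    show "?A <+>\<^bsub>R\<^esub> ?B \<subseteq> ?eR"
    proof
      fix z assume "z \<in> ?A <+>\<^bsub>R\<^esub> ?B"
      then obtain a b where ab: "a \<in> ?A" "b \<in> ?B" and z: "z = a \<oplus> b"
        by (auto simp: set_add_def')
      have "a \<in> ?eR" "b \<in> ?eR" using ab fsub gsub by blast+
      then obtain a' b' where "a' \<in> carrier R" "b' \<in> carrier R" "a = e \<otimes> a'" "b = e \<otimes> b'" by blast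
      then have "z = e \<otimes> (a' \<oplus> b')" "a' \<oplus> b' \<in> carrier R" using z c by (auto simp: r_distr)
      then show "z \<in> ?eR" by blast
    qed
    show "?eR \<subseteq> ?A <+>\<^bsub>R\<^esub> ?B"
    proof
      fix z assume "z \<in> ?eR"
      then obtain x where x: "x \<in> carrier R" "z = e \<otimes> x" by auto
      have "z = ?f \<otimes> x \<oplus> (e \<ominus> ?f) \<otimes> x"
        using x c by (simp add: minus_eq l_distr l_minus a_lcomm r_neg)
      then show "z \<in> ?A <+>\<^bsub>R\<^esub> ?B" using x unfolding set_add_def' by blast
    qed
  qed
  have summand: "direct_summand R ?A ?eR"
    unfolding direct_summand_def
    using right_ideal_principal[of ?f] right_ideal_principal[of "e \<ominus> ?f"] int sum c by auto
  have neq: "?A \<noteq> ?eR"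
  proof
    assume "?A = ?eR"
    \<comment> \<open>Left multiplication by \<open>?f\<close> fixes every element of
      \<open>?A\<close>, so \<open>e \<in> ?A\<close> forces \<open>?f \<otimes> e = e\<close>, that
      is \<open>?f = e\<close>.\<close>
    then have "e \<in> ?A" using c ee by (metis eI)
    then obtain x where "x \<in> carrier R" "e = ?f \<otimes> x" by auto
    then have "?f \<otimes> e = e" using c ff by (metis m_assoc m_closed)
    then show False using fe st by simp
  qed
  have ts': "t \<otimes> (s \<otimes> z) = z" if "z \<in> ?eR" for z
    using that c ts ee by (auto simp flip: m_assoc)
  have "bij_betw (\<lambda>z. s \<otimes> z) ?eR ?A"
    unfolding bij_betw_def
  proof
    show "inj_on (\<lambda>z. s \<otimes> z) ?eR" using ts' by (metis inj_onI)
    show "(\<lambda>z. s \<otimes> z) ` ?eR = ?A"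
    proof
      show "(\<lambda>z. s \<otimes> z) ` ?eR \<subseteq> ?A"
      proof clarify
        fix x assume x: "x \<in> carrier R"
        have "s \<otimes> (e \<otimes> x) = s \<otimes> (t \<otimes> (s \<otimes> (e \<otimes> x)))" using ts' eI[OF x] by simp
        also have "\<dots> = ?f \<otimes> (s \<otimes> (e \<otimes> x))" using x c by (simp add: m_assoc)
        finally show "s \<otimes> (e \<otimes> x) \<in> ?A" using x c by auto
      qed
      show "?A \<subseteq> (\<lambda>z. s \<otimes> z) ` ?eR"
      proof clarify
        fix x assume x: "x \<in> carrier R"
        have "?f \<otimes> x = s \<otimes> (e \<otimes> (t \<otimes> x))"
          using x c et by (simp add: m_assoc flip: m_assoc[of e t x])
        then show "?f \<otimes> x \<in> (\<lambda>z. s \<otimes> z) ` ?eR" using x c by auto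
      qed
    qed
  qed
  then have "right_ideal_iso R ?eR ?A"
    unfolding right_ideal_iso_def using c
    by (intro exI[of _ "\<lambda>z. s \<otimes> z"]) (auto simp: r_distr m_assoc)
  then show ?thesis
    unfolding infinite_idempotent_def using c ee summand neq by blast
qed

section \<open>Leavitt families\<close>

text \<open>An interface that hides the congruence classes of terms. Sinks are excluded implicitly:
  at a sink, \<open>vtx_sum\<close> would make the vertex an empty sum, against
  \<open>vtx_nonzero\<close>. The assumption \<open>generated\<close> expresses generation by the
  vertices, edges and ghost edges as an induction principle, so that no spanning set has to be
  described.\<close>

locale leavitt_family =
  ring A + KA: Module.module K A + KF: field K + fin_digraph E
  for A :: "('k, 'a) module" (structure) and K :: "('k, 'n) ring_scheme"
    and E :: "('v, 'e) pre_digraph" +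
  fixes vtx :: "'v \<Rightarrow> 'a" and edg gho :: "'e \<Rightarrow> 'a"
  assumes smult_mult: "c \<in> carrier K \<Longrightarrow> x \<in> carrier A \<Longrightarrow> y \<in> carrier A \<Longrightarrow>
      (c \<odot> x) \<otimes> y = c \<odot> (x \<otimes> y)"
    and mult_smult: "c \<in> carrier K \<Longrightarrow> x \<in> carrier A \<Longrightarrow> y \<in> carrier A \<Longrightarrow>
      x \<otimes> (c \<odot> y) = c \<odot> (x \<otimes> y)"
    and vtx_closed [simp]: "v \<in> verts E \<Longrightarrow> vtx v \<in> carrier A"
    and edg_closed [simp]: "e \<in> arcs E \<Longrightarrow> edg e \<in> carrier A"
    and gho_closed [simp]: "e \<in> arcs E \<Longrightarrow> gho e \<in> carrier A"
    and vtx_mult: "v \<in> verts E \<Longrightarrow> w \<in> verts E \<Longrightarrow> vtx v \<otimes> vtx w = (if v = w then vtx v else \<zero>)"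
    and vtx_edg [simp]: "e \<in> arcs E \<Longrightarrow> vtx (tail E e) \<otimes> edg e = edg e"
    and edg_vtx [simp]: "e \<in> arcs E \<Longrightarrow> edg e \<otimes> vtx (head E e) = edg e"
    and vtx_gho [simp]: "e \<in> arcs E \<Longrightarrow> vtx (head E e) \<otimes> gho e = gho e"
    and gho_vtx [simp]: "e \<in> arcs E \<Longrightarrow> gho e \<otimes> vtx (tail E e) = gho e"
    and gho_edg: "e \<in> arcs E \<Longrightarrow> f \<in> arcs E \<Longrightarrow>
      gho e \<otimes> edg f = (if e = f then vtx (head E e) else \<zero>)"
    and vtx_sum: "v \<in> verts E \<Longrightarrow> vtx v = (\<Oplus>e\<in>out_arcs E v. edg e \<otimes> gho e)"
    and one_sum: "\<one> = (\<Oplus>v\<in>verts E. vtx v)"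
    and vtx_nonzero: "v \<in> verts E \<Longrightarrow> vtx v \<noteq> \<zero>"
    and generated: "\<And>Q a. a \<in> carrier A \<Longrightarrow>
      (\<And>v. v \<in> verts E \<Longrightarrow> Q (vtx v)) \<Longrightarrow>
      (\<And>e. e \<in> arcs E \<Longrightarrow> Q (edg e)) \<Longrightarrow>
      (\<And>e. e \<in> arcs E \<Longrightarrow> Q (gho e)) \<Longrightarrow> Q \<zero> \<Longrightarrow>
      (\<And>x. x \<in> carrier A \<Longrightarrow> Q x \<Longrightarrow> Q (\<ominus> x)) \<Longrightarrow>
      (\<And>x y. x \<in> carrier A \<Longrightarrow> y \<in> carrier A \<Longrightarrow> Q x \<Longrightarrow> Q y \<Longrightarrow> Q (x \<oplus> y)) \<Longrightarrow>
      (\<And>x y. x \<in> carrier A \<Longrightarrow> y \<in> carrier A \<Longrightarrow> Q x \<Longrightarrow> Q y \<Longrightarrow> Q (x \<otimes> y)) \<Longrightarrow>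
      (\<And>c x. c \<in> carrier K \<Longrightarrow> x \<in> carrier A \<Longrightarrow> Q x \<Longrightarrow> Q (c \<odot> x)) \<Longrightarrow> Q a"
begin

lemmas generated_induct [consumes 1, case_names vtx edg gho zero minus add mult smult] = generated

lemma finite_out_arcs [simp]: "finite (out_arcs E v)"
  by (simp add: out_arcs_def)

lemma edg_vtx_if:
  assumes "v \<in> verts E" "e \<in> arcs E"
  shows "edg e \<otimes> vtx v = (if v = head E e then edg e else \<zero>)"
proof -
  have "edg e \<otimes> vtx v = edg e \<otimes> (vtx (head E e) \<otimes> vtx v)"
    using assms by (simp flip: m_assoc)
  then show ?thesis using assms by (auto simp: vtx_mult)
qed

lemma gho_vtx_if:
  assumes "v \<in> verts E" "e \<in> arcs E"
  shows "gho e \<otimes> vtx v = (if v = tail E e then gho e else \<zero>)"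
proof -
  have "gho e \<otimes> vtx v = gho e \<otimes> (vtx (tail E e) \<otimes> vtx v)"
    using assms by (simp flip: m_assoc)
  then show ?thesis using assms by (auto simp: vtx_mult)
qed

lemma edg_nonzero: "e \<in> arcs E \<Longrightarrow> edg e \<noteq> \<zero>"
  using gho_edg[of e e] vtx_nonzero[of "head E e"] by auto

lemma exists_mult_vtx:
  assumes "a \<in> carrier A" "a \<noteq> \<zero>"
  shows "\<exists>v\<in>verts E. a \<otimes> vtx v \<noteq> \<zero>"
proof (rule ccontr)
  assume *: "\<not> ?thesis"
  have "a = (\<Oplus>v\<in>verts E. a \<otimes> vtx v)"
    using assms one_sum by (subst finsum_rdistr[symmetric]) (auto simp flip: one_sum)
  also have "\<dots> = (\<Oplus>v\<in>verts E. \<zero>)"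
    using * by (intro finsum_cong') auto
  finally show False using assms by simp
qed

lemma exists_vtx_mult:
  assumes "a \<in> carrier A" "a \<noteq> \<zero>"
  shows "\<exists>v\<in>verts E. vtx v \<otimes> a \<noteq> \<zero>"
proof (rule ccontr)
  assume *: "\<not> ?thesis"
  have "a = (\<Oplus>v\<in>verts E. vtx v \<otimes> a)"
    using assms one_sum by (subst finsum_ldistr[symmetric]) (auto simp flip: one_sum)
  also have "\<dots> = (\<Oplus>v\<in>verts E. \<zero>)"
    using * by (intro finsum_cong') auto
  finally show False using assms by simp
qed

text \<open>Every vertex is the sum of its \<open>edg e \<otimes> gho e\<close>, so an element
  killed by all edges is killed by all vertices and hence by their sum \<open>\<one>\<close>.
  Iterating this gives arbitrarily long words that keep the product nonzero.\<close>

lemma exists_mult_edg: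
  assumes "a \<in> carrier A" "a \<noteq> \<zero>"
  shows "\<exists>e\<in>arcs E. a \<otimes> edg e \<noteq> \<zero>"
proof (rule ccontr)
  assume *: "\<not> ?thesis"
  have "a \<otimes> vtx v = \<zero>" if "v \<in> verts E" for v
  proof -
    have "a \<otimes> vtx v = (\<Oplus>e\<in>out_arcs E v. a \<otimes> (edg e \<otimes> gho e))"
      using assms that by (subst vtx_sum) (auto intro!: finsum_rdistr)
    also have "\<dots> = (\<Oplus>e\<in>out_arcs E v. \<zero>)"
      using * assms by (intro finsum_cong') (auto simp flip: m_assoc)
    finally show ?thesis by simp
  qed
  then show False using exists_mult_vtx assms by blast
qed

lemma exists_gho_mult:
  assumes "a \<in> carrier A" "a \<noteq> \<zero>"
  shows "\<exists>e\<in>arcs E. gho e \<otimes> a \<noteq> \<zero>"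
proof (rule ccontr)
  assume *: "\<not> ?thesis"
  have "vtx v \<otimes> a = \<zero>" if "v \<in> verts E" for v
  proof -
    have "vtx v \<otimes> a = (\<Oplus>e\<in>out_arcs E v. (edg e \<otimes> gho e) \<otimes> a)"
      using assms that by (subst vtx_sum) (auto intro!: finsum_ldistr)
    also have "\<dots> = (\<Oplus>e\<in>out_arcs E v. \<zero>)"
      using * assms by (intro finsum_cong') (auto simp: m_assoc)
    finally show ?thesis by simp
  qed
  then show False using exists_vtx_mult assms by blast
qed

section \<open>Combinations of real paths\<close>

fun word :: "'e list \<Rightarrow> 'a" where
  "word [] = \<one>"
| "word (e # es) = edg e \<otimes> word es"

text \<open>Formal combinations of words; words that are not paths evaluate to \<open>\<zero>\<close>, so
  composability need not be tracked.\<close>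

fun lincomb :: "('k \<times> 'v \<times> 'e list) list \<Rightarrow> 'a" where
  "lincomb [] = \<zero>"
| "lincomb ((c, v, es) # L) = c \<odot> (vtx v \<otimes> word es) \<oplus> lincomb L"

fun wellformed_term :: "'k \<times> 'v \<times> 'e list \<Rightarrow> bool" where
  "wellformed_term (c, v, es) \<longleftrightarrow> c \<in> carrier K \<and> v \<in> verts E \<and> set es \<subseteq> arcs E"

lemma word_closed [simp]: "set es \<subseteq> arcs E \<Longrightarrow> word es \<in> carrier A"
  by (induction es) auto

lemma word_append: "set es \<subseteq> arcs E \<Longrightarrow> set fs \<subseteq> arcs E \<Longrightarrow> word (es @ fs) = word es \<otimes> word fs"
  by (induction es) (auto simp: m_assoc)

lemma lincomb_closed [simp]: "\<forall>t\<in>set L. wellformed_term t \<Longrightarrow> lincomb L \<in> carrier A"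
  by (induction L rule: lincomb.induct) auto

lemma lincomb_append:
  "\<forall>t\<in>set L. wellformed_term t \<Longrightarrow> \<forall>t\<in>set M. wellformed_term t \<Longrightarrow>
    lincomb (L @ M) = lincomb L \<oplus> lincomb M"
  by (induction L rule: lincomb.induct) (auto simp: a_assoc)

lemma lincomb_smult:
  "\<forall>t\<in>set L. wellformed_term t \<Longrightarrow> c \<in> carrier K \<Longrightarrow>
    lincomb (map (\<lambda>t. (c \<otimes>\<^bsub>K\<^esub> fst t, snd t)) L) = c \<odot> lincomb L"
  by (induction L rule: lincomb.induct) (auto simp: KA.smult_assoc1 KA.smult_r_distr)

text \<open>The bound \<open>m\<close> is a budget of letters: a ghost edge acting from the left
  consumes one letter of a word, so a long enough word absorbs all ghost edges of an
  element.\<close>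

definition long_words :: "nat \<Rightarrow> 'a set" where
  "long_words m = {lincomb L | L. \<forall>t\<in>set L. wellformed_term t \<and> m \<le> length (snd (snd t))}"

lemma long_words_zero: "\<zero> \<in> long_words m"
  unfolding long_words_def by (auto intro!: exI[of _ "[]"])

lemma long_words_word:
  "v \<in> verts E \<Longrightarrow> set es \<subseteq> arcs E \<Longrightarrow> m \<le> length es \<Longrightarrow> vtx v \<otimes> word es \<in> long_words m"
  unfolding long_words_def by (auto intro!: exI[of _ "[(\<one>\<^bsub>K\<^esub>, v, es)]"])

lemma long_words_add:
  assumes "x \<in> long_words m" "y \<in> long_words m"
  shows "x \<oplus> y \<in> long_words m"
proof -
  obtain L M where "\<forall>t\<in>set L. wellformed_term t \<and> m \<le> length (snd (snd t))" "x = lincomb L"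
    "\<forall>t\<in>set M. wellformed_term t \<and> m \<le> length (snd (snd t))" "y = lincomb M"
    using assms by (auto simp: long_words_def)
  then show ?thesis unfolding long_words_def
    by (intro CollectI exI[of _ "L @ M"]) (auto simp: lincomb_append simp del: wellformed_term.simps)
qed

lemma long_words_smult:
  assumes "x \<in> long_words m" "c \<in> carrier K"
  shows "c \<odot> x \<in> long_words m"
proof -
  obtain L where "\<forall>t\<in>set L. wellformed_term t \<and> m \<le> length (snd (snd t))" "x = lincomb L"
    using assms by (auto simp: long_words_def)
  then show ?thesis unfolding long_words_def using assms
    by (intro CollectI exI[of _ "map (\<lambda>t. (c \<otimes>\<^bsub>K\<^esub> fst t, snd t)) L"]) (auto simp: lincomb_smult)
qed

lemma long_words_closed: "x \<in> long_words m \<Longrightarrow> x \<in> carrier A"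
  unfolding long_words_def by auto

lemma long_words_antimono: "n \<le> m \<Longrightarrow> long_words m \<subseteq> long_words n"
  unfolding long_words_def by fastforce

lemma mult_long_wordsI:
  assumes a: "a \<in> carrier A"
    and *: "\<And>m v es. v \<in> verts E \<Longrightarrow> set es \<subseteq> arcs E \<Longrightarrow> m + n \<le> length es \<Longrightarrow>
      a \<otimes> (vtx v \<otimes> word es) \<in> long_words m"
  shows "\<forall>m. \<forall>x\<in>long_words (m + n). a \<otimes> x \<in> long_words m"
proof (intro allI ballI)
  fix m x assume x: "x \<in> long_words (m + n)"
  have "a \<otimes> lincomb L \<in> long_words m"
    if "\<forall>t\<in>set L. wellformed_term t \<and> m + n \<le> length (snd (snd t))" for L
    using that
  proof (induction L rule: lincomb.induct)
    case 1
    then show ?case using a long_words_zero by simp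
  next
    case (2 c v es L)
    then have "\<forall>t\<in>set L. wellformed_term t" by simp
    then have "a \<otimes> lincomb ((c, v, es) # L) = c \<odot> (a \<otimes> (vtx v \<otimes> word es)) \<oplus> a \<otimes> lincomb L"
      using 2 a by (auto simp: r_distr mult_smult)
    then show ?case using 2 * by (auto intro!: long_words_add long_words_smult)
  qed
  then show "a \<otimes> x \<in> long_words m" using x by (auto simp: long_words_def)
qed

text \<open>The number \<open>n\<close> bounds the letters that \<open>a\<close> can consume: none
  for a vertex or an edge, one for a ghost edge, the maximum for a sum, the total for a product. The
  quantifier over \<open>m\<close> lies inside the one over \<open>n\<close> because the induction
  for products applies the bound of the right factor with a larger \<open>m\<close>.\<close>

lemma mult_long_words:
  assumes "a \<in> carrier A"
  shows "\<exists>n. \<forall>m. \<forall>x\<in>long_words (m + n). a \<otimes> x \<in> long_words m"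
  using assms
proof (induction a rule: generated_induct)
  case (vtx v)
  have "vtx v \<otimes> (vtx w \<otimes> word es) \<in> long_words m"
    if "w \<in> verts E" "set es \<subseteq> arcs E" "m \<le> length es" for m w es
  proof -
    have "vtx v \<otimes> (vtx w \<otimes> word es) = (vtx v \<otimes> vtx w) \<otimes> word es"
      using that vtx by (simp add: m_assoc)
    then show ?thesis using that vtx by (auto simp: vtx_mult long_words_zero long_words_word)
  qed
  then show ?case using vtx by (intro exI[of _ 0] mult_long_wordsI) auto
next
  case (edg e)
  have "edg e \<otimes> (vtx w \<otimes> word es) \<in> long_words m"
    if "w \<in> verts E" "set es \<subseteq> arcs E" "m \<le> length es" for m w es
  proof -
    have "edg e \<otimes> (vtx w \<otimes> word es) = (edg e \<otimes> vtx w) \<otimes> word es"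
      using that edg by (simp add: m_assoc)
    moreover have "edg e \<otimes> word es = vtx (tail E e) \<otimes> word (e # es)"
      using that edg by (simp flip: m_assoc)
    ultimately show ?thesis
      using that edg by (auto simp: edg_vtx_if long_words_zero simp del: word.simps intro!: long_words_word)
  qed
  then show ?case using edg by (intro exI[of _ 0] mult_long_wordsI) auto
next
  case (gho e)
  have "gho e \<otimes> (vtx w \<otimes> word es) \<in> long_words m"
    if wes: "w \<in> verts E" "set es \<subseteq> arcs E" "m + 1 \<le> length es" for m w es
  proof -
    \<comment> \<open>The extra letter in \<open>m + 1\<close> guarantees that the ghost edge meets
      a real edge.\<close>
    obtain f fs where es: "es = f # fs" using wes by (cases es) auto
    have "gho e \<otimes> (vtx w \<otimes> word es) = (gho e \<otimes> vtx w) \<otimes> (edg f \<otimes> word fs)"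
      using wes gho es by (simp add: m_assoc)
    moreover have "gho e \<otimes> (edg f \<otimes> word fs) = (gho e \<otimes> edg f) \<otimes> word fs"
      using wes gho es by (simp add: m_assoc)
    ultimately show ?thesis
      using wes gho es by (auto simp: gho_vtx_if gho_edg long_words_zero intro!: long_words_word)
  qed
  then show ?case using gho by (intro exI[of _ 1] mult_long_wordsI) auto
next
  case zero
  then show ?case using long_words_zero long_words_closed by (metis l_null)
next
  case (minus x)
  then obtain n where n: "\<And>m y. y \<in> long_words (m + n) \<Longrightarrow> x \<otimes> y \<in> long_words m" by blast
  have "\<ominus> x \<otimes> y \<in> long_words m" if "y \<in> long_words (m + n)" for m y
  proof -
    have y: "y \<in> carrier A" using that long_words_closed by blast
    have "\<ominus> x \<otimes> y = (\<ominus>\<^bsub>K\<^esub> \<one>\<^bsub>K\<^esub>) \<odot> (x \<otimes> y)"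
      using minus y by (simp add: l_minus KA.smult_l_minus)
    then show ?thesis using n[OF that] by (simp add: long_words_smult)
  qed
  then show ?case by blast
next
  case (add x y)
  then obtain n n' where n: "\<And>m z. z \<in> long_words (m + n) \<Longrightarrow> x \<otimes> z \<in> long_words m"
    "\<And>m z. z \<in> long_words (m + n') \<Longrightarrow> y \<otimes> z \<in> long_words m" by blast
  have "(x \<oplus> y) \<otimes> z \<in> long_words m" if "z \<in> long_words (m + max n n')" for m z
  proof -
    have z: "z \<in> carrier A" using that long_words_closed by blast
    have "z \<in> long_words (m + n)" "z \<in> long_words (m + n')"
      using that long_words_antimono[of "m + n" "m + max n n'"]
        long_words_antimono[of "m + n'" "m + max n n'"] by auto
    then show ?thesis using n z add by (simp add: l_distr long_words_add)
  qed
  then show ?case by blast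
next
  case (mult x y)
  then obtain n n' where n: "\<And>m z. z \<in> long_words (m + n) \<Longrightarrow> x \<otimes> z \<in> long_words m"
    "\<And>m z. z \<in> long_words (m + n') \<Longrightarrow> y \<otimes> z \<in> long_words m" by blast
  \<comment> \<open>The right factor acts first and has to leave \<open>m + n\<close> letters for
    the left one.\<close>
  have "(x \<otimes> y) \<otimes> z \<in> long_words m" if "z \<in> long_words (m + (n + n'))" for m z
  proof -
    have "z \<in> carrier A" using that long_words_closed by blast
    then show ?thesis using n(1)[OF n(2)[of z "m + n"]] that mult by (simp add: m_assoc add.assoc)
  qed
  then show ?case by blast
next
  case (smult c x)
  then obtain n where n: "\<And>m y. y \<in> long_words (m + n) \<Longrightarrow> x \<otimes> y \<in> long_words m" by blast
  have "(c \<odot> x) \<otimes> y \<in> long_words m" if "y \<in> long_words (m + n)" for m y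
    using n[OF that] long_words_closed[OF that] smult by (simp add: smult_mult long_words_smult)
  then show ?case by blast
qed

lemma exists_mult_word:
  assumes "a \<in> carrier A" "a \<noteq> \<zero>"
  shows "\<exists>es. set es \<subseteq> arcs E \<and> length es = n \<and> a \<otimes> word es \<noteq> \<zero>"
  using assms
proof (induction n arbitrary: a)
  case 0
  then show ?case by (intro exI[of _ "[]"]) simp
next
  case (Suc n)
  then obtain e where e: "e \<in> arcs E" "a \<otimes> edg e \<noteq> \<zero>" using exists_mult_edg by blast
  then obtain es where "set es \<subseteq> arcs E \<and> length es = n \<and> (a \<otimes> edg e) \<otimes> word es \<noteq> \<zero>"
    using Suc.IH[of "a \<otimes> edg e"] Suc.prems by auto
  then show ?case using e Suc.prems by (intro exI[of _ "e # es"]) (auto simp: m_assoc)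
qed

text \<open>Two requirements on the right factor meet here: its word must be long enough to absorb
  the ghost edges of \<open>a\<close>, and it must not annihilate \<open>a\<close>. The second can
  be met at every length by \<open>exists_mult_word\<close>.\<close>

lemma exists_mult_in_words:
  assumes "a \<in> carrier A" "a \<noteq> \<zero>"
  shows "\<exists>x\<in>carrier A. a \<otimes> x \<in> long_words 0 \<and> a \<otimes> x \<noteq> \<zero>"
proof -
  obtain n where "\<forall>m. \<forall>x\<in>long_words (m + n). a \<otimes> x \<in> long_words m"
    using mult_long_words[OF assms(1)] by blast
  then have n: "\<And>x. x \<in> long_words (0 + n) \<Longrightarrow> a \<otimes> x \<in> long_words 0" by blast
  obtain v where v: "v \<in> verts E" "a \<otimes> vtx v \<noteq> \<zero>" using exists_mult_vtx assms by blast
  moreover have "a \<otimes> vtx v \<in> carrier A" using v assms by simp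
  ultimately obtain es where es: "set es \<subseteq> arcs E" "length es = n" "(a \<otimes> vtx v) \<otimes> word es \<noteq> \<zero>"
    using exists_mult_word[of "a \<otimes> vtx v" n] by blast
  moreover have "vtx v \<otimes> word es \<in> long_words (0 + n)"
    using es v by (intro long_words_word) auto
  ultimately show ?thesis using n v(1) assms
    by (intro bexI[of _ "vtx v \<otimes> word es"]) (simp_all add: m_assoc)
qed

section \<open>Reducing a combination of real paths to a vertex\<close>

fun peel :: "'e \<Rightarrow> ('k \<times> 'v \<times> 'e list) list \<Rightarrow> ('k \<times> 'v \<times> 'e list) list" where
  "peel e [] = []"
| "peel e ((c, v, []) # L) = peel e L"
| "peel e ((c, v, f # es) # L) =
    (if v = tail E e \<and> f = e then [(c, head E e, es)] else []) @ peel e L"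

definition proper_terms :: "('k \<times> 'v \<times> 'e list) list \<Rightarrow> bool" where
  "proper_terms L \<longleftrightarrow> (\<forall>t\<in>set L. wellformed_term t \<and> snd (snd t) \<noteq> [])"

lemma proper_terms_simps [simp]:
  "proper_terms []"
  "proper_terms (t # L) \<longleftrightarrow> wellformed_term t \<and> snd (snd t) \<noteq> [] \<and> proper_terms L"
  by (auto simp: proper_terms_def)

lemma wellformed_peel:
  "e \<in> arcs E \<Longrightarrow> proper_terms L \<Longrightarrow> \<forall>t\<in>set (peel e L). wellformed_term t"
  by (induction e L rule: peel.induct) auto

text \<open>Left multiplication by \<open>gho e\<close> removes a leading \<open>e\<close> and kills
  words with another first letter. Empty words are excluded, because \<open>gho e\<close> times a
  vertex is a ghost edge or zero, whereas \<open>peel\<close> just drops such terms.\<close>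

lemma lincomb_peel:
  assumes "e \<in> arcs E" "proper_terms L"
  shows "gho e \<otimes> lincomb L = lincomb (peel e L)"
  using assms
proof (induction e L rule: peel.induct)
  case (3 e c v f es L)
  have ok: "\<forall>t\<in>set L. wellformed_term t" "\<forall>t\<in>set (peel e L). wellformed_term t"
    using 3 wellformed_peel by (auto simp: proper_terms_def)
  have f: "v \<in> verts E" "c \<in> carrier K" "f \<in> arcs E" "set es \<subseteq> arcs E" using 3 by auto
  have "gho e \<otimes> (vtx v \<otimes> (edg f \<otimes> word es)) = (gho e \<otimes> vtx v) \<otimes> (edg f \<otimes> word es)"
    using f 3 by (simp add: m_assoc)
  also have "\<dots> = (if v = tail E e then (gho e \<otimes> edg f) \<otimes> word es else \<zero>)"
    using f 3 by (simp add: gho_vtx_if m_assoc)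
  also have "\<dots> = (if v = tail E e \<and> f = e then vtx (head E e) \<otimes> word es else \<zero>)"
    using f 3 by (auto simp: gho_edg)
  finally show ?case
    using f 3 ok by (auto simp: r_distr mult_smult)
qed auto

lemma lincomb_append_edge:
  assumes "e \<in> arcs E" "\<forall>t\<in>set L. wellformed_term t"
  shows "lincomb (map (\<lambda>(c, v, es). (c, v, es @ [e])) L) = lincomb L \<otimes> edg e"
  using assms
  by (induction L rule: lincomb.induct) (auto simp: l_distr smult_mult word_append m_assoc)

lemma length_peel: "length (peel e L) \<le> length L"
  by (induction e L rule: peel.induct) auto

text \<open>A term that survives loses one letter, and a term that is dropped had at least one;
  hence the loss of at least \<open>length L\<close>. This makes the total length a termination
  measure for peeling.\<close>

lemma total_length_peel:
  "proper_terms L \<Longrightarrow>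
    (\<Sum>t\<leftarrow>peel e L. length (snd (snd t))) + length L \<le> (\<Sum>t\<leftarrow>L. length (snd (snd t)))"
  by (induction e L rule: peel.induct) auto

lemma lincomb_filter_vtx:
  assumes "w \<in> verts E" "\<forall>t\<in>set L. wellformed_term t"
  shows "vtx w \<otimes> lincomb L = lincomb (filter (\<lambda>t. fst (snd t) = w) L)"
  using assms
proof (induction L rule: lincomb.induct)
  case (2 c v es L)
  then have "vtx w \<otimes> (vtx v \<otimes> word es) = (vtx w \<otimes> vtx v) \<otimes> word es"
    by (simp add: m_assoc)
  then show ?case using 2 by (auto simp: r_distr mult_smult vtx_mult)
qed simp

lemma lincomb_partition:
  assumes "\<forall>t\<in>set L. wellformed_term t"
  shows "lincomb L = lincomb (filter (\<lambda>t. snd (snd t) = []) L) \<oplus>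
    lincomb (filter (\<lambda>t. snd (snd t) \<noteq> []) L)"
  using assms
  by (induction L rule: lincomb.induct) (auto simp: a_assoc a_lcomm)

lemma vtx_mult_trivial:
  assumes "w \<in> verts E" "\<forall>t\<in>set L. wellformed_term t \<and> snd (snd t) = []"
  shows "\<exists>c\<in>carrier K. vtx w \<otimes> lincomb L = c \<odot> vtx w"
  using assms
proof (induction L rule: lincomb.induct)
  case 1
  then show ?case by (intro bexI[of _ "\<zero>\<^bsub>K\<^esub>"]) auto
next
  case (2 c v es L)
  then obtain d where d: "d \<in> carrier K" "vtx w \<otimes> lincomb L = d \<odot> vtx w" by auto
  have "vtx w \<otimes> lincomb ((c, v, es) # L) = c \<odot> (vtx w \<otimes> vtx v) \<oplus> d \<odot> vtx w"
    using 2 d by (simp add: r_distr mult_smult)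
  then show ?case
    using 2 d by (cases "v = w")
      (auto simp: vtx_mult simp flip: KA.smult_l_distr)
qed

lemma mult_sandwich:
  assumes "x \<in> carrier A" "g \<in> carrier A" "a \<in> carrier A" "h \<in> carrier A" "y \<in> carrier A"
  shows "(x \<otimes> g) \<otimes> a \<otimes> (h \<otimes> y) = x \<otimes> (g \<otimes> a \<otimes> h) \<otimes> y"
  using assms by (simp add: m_assoc)

text \<open>Conjugating by an edge other than the first letter of some word kills that word, keeps
  the leading vertex term and does not create new words.\<close>

lemma reduce_leading_vtx:
  assumes exit: "\<And>v f. v \<in> verts E \<Longrightarrow> \<exists>e\<in>out_arcs E v. e \<noteq> f"
    and "w \<in> verts E" "c \<in> carrier K" "c \<noteq> \<zero>\<^bsub>K\<^esub>" "proper_terms L"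
  shows "\<exists>x\<in>carrier A. \<exists>y\<in>carrier A. \<exists>u\<in>verts E. x \<otimes> (c \<odot> vtx w \<oplus> lincomb L) \<otimes> y = vtx u"
  using assms(2-)
proof (induction "length L" arbitrary: L w rule: less_induct)
  case less
  show ?case
  proof (cases L)
    case Nil
    have "inv\<^bsub>K\<^esub> c \<in> carrier K" "c \<otimes>\<^bsub>K\<^esub> inv\<^bsub>K\<^esub> c = \<one>\<^bsub>K\<^esub>"
      using less KF.field_Units by auto
    then have "(inv\<^bsub>K\<^esub> c \<odot> vtx w) \<otimes> (c \<odot> vtx w \<oplus> lincomb L) \<otimes> vtx w = vtx w"
      using less Nil by (simp add: smult_mult mult_smult vtx_mult flip: KA.smult_assoc1)
    then show ?thesis
      using less \<open>inv\<^bsub>K\<^esub> c \<in> carrier K\<close> by (meson KA.smult_closed vtx_closed)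
  next
    case (Cons t M)
    obtain d v f fs where t: "t = (d, v, f # fs)"
      using less Cons by (cases t; cases "snd (snd t)") auto
    \<comment> \<open>The measure is the number of terms: conjugation by \<open>e\<close> removes a
      first letter and appends \<open>e\<close>, so surviving words keep their length, but the term
      starting with \<open>f\<close> disappears.\<close>
    obtain e where e: "e \<in> out_arcs E w" "e \<noteq> f" using exit less by blast
    then have e': "e \<in> arcs E" "tail E e = w" by auto
    define N where "N = map (\<lambda>(c, v, es). (c, v, es @ [e])) (peel e L)"
    have wfL: "\<forall>t\<in>set L. wellformed_term t" using less by (auto simp: proper_terms_def)
    have wfp: "\<forall>t\<in>set (peel e L). wellformed_term t" using wellformed_peel e' less by blast
    have "peel e L = peel e M" using Cons t e by auto
    then have "length N < length L" using length_peel[of e M] Cons by (simp add: N_def)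
    moreover have "proper_terms N"
      using wfp e' by (auto simp: N_def proper_terms_def)
    ultimately obtain x y u where xyu: "x \<in> carrier A" "y \<in> carrier A" "u \<in> verts E"
      "x \<otimes> (c \<odot> vtx (head E e) \<oplus> lincomb N) \<otimes> y = vtx u"
      using less e' by (metis head_in_verts)
    have "gho e \<otimes> (c \<odot> vtx w \<oplus> lincomb L) \<otimes> edg e = c \<odot> (gho e \<otimes> vtx w \<otimes> edg e) \<oplus> lincomb N"
      unfolding N_def using less e' wfL wfp
      by (simp add: lincomb_append_edge lincomb_peel r_distr l_distr smult_mult mult_smult)
    also have "gho e \<otimes> vtx w \<otimes> edg e = vtx (head E e)"
      using e' by (auto simp: gho_edg)
    finally have "(x \<otimes> gho e) \<otimes> (c \<odot> vtx w \<oplus> lincomb L) \<otimes> (edg e \<otimes> y) = vtx u"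
      using xyu e' less wfL by (subst mult_sandwich) simp_all
    then show ?thesis using xyu e' by (meson edg_closed gho_closed m_closed)
  qed
qed

text \<open>While the empty words contribute nothing, a suitable ghost edge shortens the remaining
  words without reaching zero. As soon as they contribute, some vertex \<open>w\<close> isolates a
  nonzero multiple of itself, and \<open>reduce_leading_vtx\<close> applies.\<close>

lemma reduce_lincomb:
  assumes exit: "\<And>v f. v \<in> verts E \<Longrightarrow> \<exists>e\<in>out_arcs E v. e \<noteq> f"
    and "\<forall>t\<in>set L. wellformed_term t" "lincomb L \<noteq> \<zero>"
  shows "\<exists>x\<in>carrier A. \<exists>y\<in>carrier A. \<exists>u\<in>verts E. x \<otimes> lincomb L \<otimes> y = vtx u"
  using assms(2-)
proof (induction "\<Sum>t\<leftarrow>L. length (snd (snd t))" arbitrary: L rule: less_induct)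
  case less
  define L0 where "L0 = filter (\<lambda>t. snd (snd t) = []) L"
  define L1 where "L1 = filter (\<lambda>t. snd (snd t) \<noteq> []) L"
  have L: "lincomb L = lincomb L0 \<oplus> lincomb L1"
    unfolding L0_def L1_def using less lincomb_partition by blast
  have wf0: "\<forall>t\<in>set L0. wellformed_term t" and p1: "proper_terms L1"
    and wf1: "\<forall>t\<in>set L1. wellformed_term t"
    using less by (auto simp: L0_def L1_def proper_terms_def)
  show ?case
  \<comment> \<open>The test concerns the value and not the list: empty words may be present and
    cancel.\<close>
  proof (cases "lincomb L0 = \<zero>")
    case True
    then have L1: "lincomb L = lincomb L1" "lincomb L1 \<noteq> \<zero>" using L wf1 less by auto
    then obtain e where e: "e \<in> arcs E" "gho e \<otimes> lincomb L1 \<noteq> \<zero>"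
      using exists_gho_mult wf1 by (metis lincomb_closed)
    have peel: "gho e \<otimes> lincomb L1 = lincomb (peel e L1)" using lincomb_peel e p1 by blast
    \<comment> \<open>Since \<open>L1\<close> is not empty, the bound of
      \<open>total_length_peel\<close> is a strict decrease.\<close>
    have "0 < length L1" using L1(2) by auto
    moreover have "(\<Sum>t\<leftarrow>L1. length (snd (snd t))) \<le> (\<Sum>t\<leftarrow>L. length (snd (snd t)))"
      unfolding L1_def by (induction L) auto
    ultimately have "(\<Sum>t\<leftarrow>peel e L1. length (snd (snd t))) < (\<Sum>t\<leftarrow>L. length (snd (snd t)))"
      using total_length_peel[OF p1, of e] by linarith
    then obtain x y u where xyu: "x \<in> carrier A" "y \<in> carrier A" "u \<in> verts E"
      "x \<otimes> lincomb (peel e L1) \<otimes> y = vtx u"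
      using less.hyps wellformed_peel[OF e(1) p1] e peel by metis
    then have "(x \<otimes> gho e) \<otimes> lincomb L \<otimes> y = vtx u"
      using e L1 wf1 peel by (metis gho_closed lincomb_closed m_assoc)
    then show ?thesis using xyu e by (meson gho_closed m_closed)
  next
    case False
    then obtain w where w: "w \<in> verts E" "vtx w \<otimes> lincomb L0 \<noteq> \<zero>"
      using exists_vtx_mult wf0 by (metis lincomb_closed)
    moreover have "\<forall>t\<in>set L0. wellformed_term t \<and> snd (snd t) = []"
      using wf0 by (auto simp: L0_def)
    ultimately obtain c where c: "c \<in> carrier K" "vtx w \<otimes> lincomb L0 = c \<odot> vtx w"
      using vtx_mult_trivial by blast
    then have "c \<noteq> \<zero>\<^bsub>K\<^esub>" using w by auto
    moreover have "proper_terms (filter (\<lambda>t. fst (snd t) = w) L1)"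
      using p1 by (auto simp: proper_terms_def)
    ultimately obtain x y u where xyu: "x \<in> carrier A" "y \<in> carrier A" "u \<in> verts E"
      "x \<otimes> (c \<odot> vtx w \<oplus> vtx w \<otimes> lincomb L1) \<otimes> y = vtx u"
      using reduce_leading_vtx[OF exit w(1) c(1)] lincomb_filter_vtx[OF w(1) wf1] by metis
    have "vtx w \<otimes> lincomb L = c \<odot> vtx w \<oplus> vtx w \<otimes> lincomb L1"
      using L c w wf0 wf1 by (simp add: r_distr)
    then have "(x \<otimes> vtx w) \<otimes> lincomb L \<otimes> y = vtx u"
      using xyu w less by (metis vtx_closed lincomb_closed m_assoc)
    then show ?thesis using xyu w by (meson vtx_closed m_closed)
  qed
qed

lemma reduces_to_vertex:
  assumes exit: "\<And>v f. v \<in> verts E \<Longrightarrow> \<exists>e\<in>out_arcs E v. e \<noteq> f"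
    and a: "a \<in> carrier A" "a \<noteq> \<zero>"
  shows "\<exists>x\<in>carrier A. \<exists>y\<in>carrier A. \<exists>u\<in>verts E. x \<otimes> a \<otimes> y = vtx u"
proof -
  obtain z where z: "z \<in> carrier A" "a \<otimes> z \<in> long_words 0" "a \<otimes> z \<noteq> \<zero>"
    using exists_mult_in_words a by blast
  then obtain L where "\<forall>t\<in>set L. wellformed_term t" "a \<otimes> z = lincomb L"
    by (auto simp: long_words_def)
  then obtain x y u where xyu: "x \<in> carrier A" "y \<in> carrier A" "u \<in> verts E"
    "x \<otimes> (a \<otimes> z) \<otimes> y = vtx u"
    using reduce_lincomb[OF exit] z by metis
  then have "x \<otimes> a \<otimes> (z \<otimes> y) = vtx u" using a z by (simp add: m_assoc)
  then show ?thesis using xyu z by (meson m_closed)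
qed

section \<open>Strong connectedness, simplicity and infinite idempotents\<close>

lemma path_elements:
  assumes "(v, w) \<in> (arcs_ends E)\<^sup>*" "v \<in> verts E"
  shows "\<exists>p\<in>carrier A. \<exists>q\<in>carrier A. q \<otimes> p = vtx w \<and> vtx v \<otimes> p = p \<and> p \<otimes> vtx w = p \<and>
    q \<otimes> vtx v = q \<and> vtx w \<otimes> q = q"
  using assms
proof (induction rule: rtrancl_induct)
  case base
  then show ?case by (intro bexI[of _ "vtx v"]) (auto simp: vtx_mult)
next
  case (step u w)
  then obtain p q where pq: "p \<in> carrier A" "q \<in> carrier A" "q \<otimes> p = vtx u" "vtx v \<otimes> p = p"
    "q \<otimes> vtx v = q" by auto
  obtain e where e: "e \<in> arcs E" "tail E e = u" "head E e = w"
    using step by (auto simp: arcs_ends_def arc_to_ends_def)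
  \<comment> \<open>Here \<open>p\<close> is a path and \<open>q\<close> its ghost read backwards.
    Adding an edge at the end of \<open>p\<close> adds its ghost at the front of \<open>q\<close>,
    so the product collapses from the inside.\<close>
  have "(gho e \<otimes> q) \<otimes> (p \<otimes> edg e) = gho e \<otimes> (q \<otimes> p) \<otimes> edg e"
    using pq(1,2) e by (simp add: m_assoc)
  also have "\<dots> = vtx w" using pq e by (auto simp: gho_edg)
  finally have "(gho e \<otimes> q) \<otimes> (p \<otimes> edg e) = vtx w" .
  moreover have "vtx v \<otimes> (p \<otimes> edg e) = p \<otimes> edg e"
    using pq e step.prems by (metis edg_closed m_assoc vtx_closed)
  moreover have "(p \<otimes> edg e) \<otimes> vtx w = p \<otimes> edg e"
    using pq e by (metis edg_closed edg_vtx head_in_verts m_assoc vtx_closed)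
  moreover have "(gho e \<otimes> q) \<otimes> vtx v = gho e \<otimes> q"
    using pq e step.prems by (metis gho_closed m_assoc vtx_closed)
  moreover have "vtx w \<otimes> (gho e \<otimes> q) = gho e \<otimes> q"
    using pq e by (metis gho_closed vtx_gho head_in_verts m_assoc vtx_closed)
  moreover have "p \<otimes> edg e \<in> carrier A" "gho e \<otimes> q \<in> carrier A" using pq e by auto
  ultimately show ?case by blast
qed

lemma purely_infinite_simple_if_connected:
  assumes exit: "\<And>v f. v \<in> verts E \<Longrightarrow> \<exists>e\<in>out_arcs E v. e \<noteq> f"
    and conn: "\<And>v w. v \<in> verts E \<Longrightarrow> w \<in> verts E \<Longrightarrow> (v, w) \<in> (arcs_ends E)\<^sup>*"
    and nonempty: "verts E \<noteq> {}"
  shows "purely_infinite_simple A"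
proof -
  have "simple_ring A"
    unfolding simple_ring_def
  proof
    obtain v where v: "v \<in> verts E" using nonempty by blast
    then show "\<exists>x\<in>carrier A. \<exists>y\<in>carrier A. x \<otimes> y \<noteq> \<zero>"
      by (intro bexI[of _ "vtx v"]) (auto simp: vtx_mult vtx_nonzero)
    show "\<forall>I. two_sided_ideal I A \<longrightarrow> I = {\<zero>} \<or> I = carrier A"
    proof (intro allI impI)
      fix I assume I: "two_sided_ideal I A"
      then interpret I: additive_subgroup I A by (simp add: two_sided_ideal_def right_ideal_def)
      have Il: "x \<otimes> a \<in> I" and Ir: "a \<otimes> x \<in> I" if "a \<in> I" "x \<in> carrier A" for a x
        using that I by (auto simp: two_sided_ideal_def right_ideal_def)
      have "I = carrier A" if nz: "I \<noteq> {\<zero>}"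
      proof -
        obtain a where a: "a \<in> I" "a \<noteq> \<zero>" using nz I.zero_closed by blast
        then obtain x y u where xyu: "x \<in> carrier A" "y \<in> carrier A" "u \<in> verts E"
          "x \<otimes> a \<otimes> y = vtx u" using reduces_to_vertex[OF exit] I.a_Hcarr by metis
        then have u: "vtx u \<in> I" using Il Ir a by metis
        have vI: "vtx w \<in> I" if w: "w \<in> verts E" for w
        proof -
          \<comment> \<open>With these elements \<open>vtx w\<close> equals
            \<open>q \<otimes> vtx u \<otimes> p\<close>, which lies in the ideal.\<close>
          obtain p q where "p \<in> carrier A" "q \<in> carrier A" "q \<otimes> p = vtx w" "vtx u \<otimes> p = p"
            using path_elements[OF conn[OF xyu(3) w] xyu(3)] by blast
          then show ?thesis using Il Ir u by metis
        qed
        have "(\<Oplus>v\<in>V. vtx v) \<in> I" if "V \<subseteq> verts E" for V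
        proof -
          have "finite V" using that finite_subset finite_verts by blast
          then show ?thesis using that
          proof (induction V)
            case (insert v V)
            then show ?case using vI I.a_closed by (subst finsum_insert) auto
          qed simp
        qed
        then have "\<one> \<in> I" by (simp add: one_sum)
        then show ?thesis using Il I.a_Hcarr by (metis r_one subsetI subset_antisym)
      qed
      then show "I = {\<zero>} \<or> I = carrier A" by blast
    qed
  qed
  moreover have "purely_infinite A"
    unfolding purely_infinite_def
  proof (intro allI impI)
    fix I assume I: "right_ideal I A \<and> I \<noteq> {\<zero>}"
    then interpret I: additive_subgroup I A by (simp add: right_ideal_def)
    obtain a where a: "a \<in> I" "a \<noteq> \<zero>" using I I.zero_closed by blast
    then have aA: "a \<in> carrier A" using I.a_Hcarr by simp
    obtain x y u where xyu: "x \<in> carrier A" "y \<in> carrier A" "u \<in> verts E"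
      "x \<otimes> a \<otimes> y = vtx u" using reduces_to_vertex[OF exit aA a(2)] by blast
    \<comment> \<open>Any edge leaving \<open>u\<close> will do; \<open>undefined\<close> only fills
      the place of the edge to be avoided.\<close>
    obtain e where e: "e \<in> arcs E" "tail E e = u" using exit[OF xyu(3), of undefined] by auto
    obtain f where f: "f \<in> arcs E" "tail E f = u" "f \<noteq> e" using exit[OF xyu(3), of e] by auto
    obtain p q where pq: "p \<in> carrier A" "q \<in> carrier A" "q \<otimes> p = vtx u" "vtx (head E e) \<otimes> p = p"
      "p \<otimes> vtx u = p" "vtx u \<otimes> q = q"
      using path_elements[OF conn[of "head E e" u]] e xyu by (metis head_in_verts)
    \<comment> \<open>The path \<open>p\<close> leads from the head of \<open>e\<close> back to
      \<open>u\<close>, so \<open>s\<close> is a closed path at \<open>u\<close> beginning with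
      \<open>e\<close>, and \<open>t\<close> is its ghost.\<close>
    define s t where "s = edg e \<otimes> p" and "t = q \<otimes> gho e"
    have st: "s \<in> carrier A" "t \<in> carrier A" using e pq by (auto simp: s_def t_def)
    have u_st: "vtx u \<otimes> s = s" "s \<otimes> vtx u = s" "vtx u \<otimes> t = t" "t \<otimes> vtx u = t"
      unfolding s_def t_def using e pq xyu(3)
      by (metis edg_closed gho_closed vtx_edg gho_vtx vtx_closed m_assoc)+
    have "t \<otimes> s = q \<otimes> (gho e \<otimes> edg e \<otimes> p)" using e pq by (simp add: s_def t_def m_assoc)
    then have ts: "t \<otimes> s = vtx u" using e pq by (simp add: gho_edg)
    \<comment> \<open>The second edge \<open>f\<close> separates \<open>s \<otimes> t\<close> from
      \<open>vtx u\<close>: the former kills \<open>edg f\<close>, the latter fixes it.\<close>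
    have "s \<otimes> t \<otimes> edg f = s \<otimes> q \<otimes> (gho e \<otimes> edg f)"
      using e f pq st by (simp add: t_def m_assoc)
    then have "s \<otimes> t \<otimes> edg f = \<zero>" using e f pq st by (simp add: gho_edg)
    moreover have "vtx u \<otimes> edg f \<noteq> \<zero>" using f edg_nonzero by auto
    ultimately have st_ne: "s \<otimes> t \<noteq> vtx u" by auto
    \<comment> \<open>Cutting \<open>x\<close> and \<open>y\<close> down to the corner at
      \<open>u\<close> preserves the product. Then \<open>x' \<otimes> b = vtx u\<close> for
      \<open>b = a \<otimes> y'\<close>, so \<open>b \<otimes> x'\<close> is an idempotent
      equivalent to \<open>vtx u\<close> that lies in the right ideal.\<close>
    define x' y' where "x' = vtx u \<otimes> x" and "y' = y \<otimes> vtx u"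
    have xy': "x' \<in> carrier A" "y' \<in> carrier A" "vtx u \<otimes> x' = x'" "y' \<otimes> vtx u = y'"
      unfolding x'_def y'_def using xyu(1-3)
      by (simp_all add: m_assoc vtx_mult) (simp add: vtx_mult flip: m_assoc)
    have "x' \<otimes> (a \<otimes> y') = vtx u \<otimes> (x \<otimes> a \<otimes> y) \<otimes> vtx u"
      using xyu(1-3) aA by (simp add: x'_def y'_def m_assoc)
    then have xay: "x' \<otimes> (a \<otimes> y') = vtx u" using xyu by (simp add: vtx_mult)
    define b where "b = a \<otimes> y'"
    have b: "b \<in> carrier A" "x' \<otimes> b = vtx u" "b \<otimes> vtx u = b"
      using aA xy' xay xyu(3) by (auto simp: b_def m_assoc)
    have bI: "b \<otimes> z \<in> I" if "z \<in> carrier A" for z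
      using I a that xy' by (auto simp: b_def right_ideal_def)
    have red: "x' \<otimes> (b \<otimes> z) = vtx u \<otimes> z" if "z \<in> carrier A" for z
      using that b xy' by (simp flip: m_assoc)
    have redu: "vtx u \<otimes> (s \<otimes> z) = s \<otimes> z" "vtx u \<otimes> (t \<otimes> z) = t \<otimes> z" "vtx u \<otimes> (x' \<otimes> z) = x' \<otimes> z"
      "t \<otimes> (s \<otimes> z) = vtx u \<otimes> z"
      if "z \<in> carrier A" for z
      using that u_st xy' st xyu ts by (simp_all flip: m_assoc)
    \<comment> \<open>The map sending \<open>z\<close> to
      \<open>b \<otimes> (z \<otimes> x')\<close> is multiplicative on the corner at
      \<open>u\<close> and sends \<open>vtx u\<close> to \<open>b \<otimes> x'\<close>. It
      transports \<open>s\<close> and \<open>t\<close>.\<close>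
    have "infinite_idempotent A (b \<otimes> x')"
    proof (rule infinite_idempotentI)
      show "b \<otimes> x' \<in> carrier A" "b \<otimes> (s \<otimes> x') \<in> carrier A" "b \<otimes> (t \<otimes> x') \<in> carrier A"
        using b st xy' by auto
      show "b \<otimes> x' \<otimes> (b \<otimes> (s \<otimes> x')) = b \<otimes> (s \<otimes> x')" "b \<otimes> x' \<otimes> (b \<otimes> (t \<otimes> x')) = b \<otimes> (t \<otimes> x')"
        "b \<otimes> (t \<otimes> x') \<otimes> (b \<otimes> x') = b \<otimes> (t \<otimes> x')"
        "b \<otimes> (t \<otimes> x') \<otimes> (b \<otimes> (s \<otimes> x')) = b \<otimes> x'"
        using b(1) st xy' by (simp_all add: m_assoc red redu)
      show "b \<otimes> (s \<otimes> x') \<otimes> (b \<otimes> (t \<otimes> x')) \<noteq> b \<otimes> x'"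
      proof
        assume "b \<otimes> (s \<otimes> x') \<otimes> (b \<otimes> (t \<otimes> x')) = b \<otimes> x'"
        \<comment> \<open>Multiplying by \<open>x'\<close> on the left and by \<open>b\<close> on
          the right undoes the transport and would give
          \<open>s \<otimes> t = vtx u\<close>.\<close>
        then have "x' \<otimes> (b \<otimes> (s \<otimes> x') \<otimes> (b \<otimes> (t \<otimes> x'))) \<otimes> b = x' \<otimes> (b \<otimes> x') \<otimes> b" by simp
        moreover have "x' \<otimes> (b \<otimes> (s \<otimes> x') \<otimes> (b \<otimes> (t \<otimes> x'))) \<otimes> b = s \<otimes> t"
          using b st xy' u_st xyu by (simp add: m_assoc red redu)
        moreover have "x' \<otimes> (b \<otimes> x') \<otimes> b = vtx u"
          using b st xy' u_st xyu by (simp add: m_assoc red vtx_mult)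
        ultimately show False using st_ne by simp
      qed
    qed
    then show "\<exists>e\<in>I. infinite_idempotent A e" using bI xy' by blast
  qed
  ultimately show ?thesis by (simp add: purely_infinite_simple_def)
qed

end

section \<open>Leavitt path algebras as presented algebras\<close>

locale leavitt_presentation = field K + wf_digraph E
  for K :: "('k, 'n) ring_scheme" (structure) and E :: "('v, 'e) pre_digraph"
begin

lemma vertex_term: "v \<in> verts E \<Longrightarrow> Gen (Vertex v) \<in> alg_terms K (leavitt_gens E)"
  and edge_term: "e \<in> arcs E \<Longrightarrow> Gen (Edge e) \<in> alg_terms K (leavitt_gens E)"
  and ghost_term: "e \<in> arcs E \<Longrightarrow> Gen (Ghost e) \<in> alg_terms K (leavitt_gens E)"
  by (auto simp: leavitt_gens_def intro: alg_terms.intros)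

lemma Sum_list_term:
  "set ts \<subseteq> alg_terms K (leavitt_gens E) \<Longrightarrow> Sum_list ts \<in> alg_terms K (leavitt_gens E)"
  by (induction ts) (auto simp: Sum_list_def intro: alg_terms.intros)

lemma leavitt_rels_terms:
  "leavitt_rels E \<subseteq> alg_terms K (leavitt_gens E) \<times> alg_terms K (leavitt_gens E)"
proof -
  have "t \<in> alg_terms K (leavitt_gens E) \<and> u \<in> alg_terms K (leavitt_gens E)"
    if "(t, u) \<in> leavitt_rels E" for t u
    using that
    by (induction rule: leavitt_rels.induct)
      (auto intro!: vertex_term edge_term ghost_term Sum_list_term alg_terms.intros(2,5))
  then show ?thesis by auto
qed

sublocale presentation K "leavitt_gens E" "leavitt_rels E"
  by unfold_locales (rule leavitt_rels_terms)

end

section \<open>The branching representation\<close>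

definition infinite_path :: "('v, 'e) pre_digraph \<Rightarrow> (nat \<Rightarrow> 'e) \<Rightarrow> bool" where
  "infinite_path E y \<longleftrightarrow> (\<forall>i. y i \<in> arcs E \<and> tail E (y (Suc i)) = head E (y i))"

text \<open>Edges act on functions on infinite paths by shifting the path. The integer coordinate
  records the degree, weighted by \<open>d\<close>: the representation with \<open>d = 0\<close> forgets the grading of
  the algebra, that with \<open>d = 1\<close> respects it.\<close>

locale path_representation = leavitt_presentation K E
  for K :: "('k, 'n) ring_scheme" (structure) and E :: "('v, 'e) pre_digraph" +
  fixes Q :: "'v set" and d :: int
  assumes Q_closed: "e \<in> arcs E \<Longrightarrow> tail E e \<in> Q \<longleftrightarrow> head E e \<in> Q"
begin

text \<open>A test of the first vertex is enough: by \<open>Q_closed\<close> a path that starts in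
  \<open>Q\<close> stays there, and extending it backwards does not leave \<open>Q\<close>
  either.\<close>

definition paths :: "(nat \<Rightarrow> 'e) set" where
  "paths = {y. infinite_path E y \<and> tail E (y 0) \<in> Q}"

text \<open>On the indicator function of a path, \<open>Edge e\<close> prepends \<open>e\<close> and
  raises the degree by \<open>d\<close>, and \<open>Ghost e\<close> removes a leading
  \<open>e\<close> and lowers it. The formulas extend this action to arbitrary functions, so no
  finiteness of supports has to be maintained.\<close>

fun gen_op :: "('v, 'e) leavitt_gen \<Rightarrow> ((nat \<Rightarrow> 'e) \<times> int \<Rightarrow> 'k) \<Rightarrow> (nat \<Rightarrow> 'e) \<times> int \<Rightarrow> 'k" where
  "gen_op (Vertex v) \<phi> (y, n) = (if y \<in> paths \<and> tail E (y 0) = v then \<phi> (y, n) else \<zero>)"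
| "gen_op (Edge e) \<phi> (y, n) = (if y \<in> paths \<and> y 0 = e then \<phi> (\<lambda>i. y (Suc i), n - d) else \<zero>)"
| "gen_op (Ghost e) \<phi> (y, n) =
    (if y \<in> paths \<and> tail E (y 0) = head E e then \<phi> (case_nat e y, n + d) else \<zero>)"

primrec term_op :: "('k, ('v, 'e) leavitt_gen) alg_term \<Rightarrow> ((nat \<Rightarrow> 'e) \<times> int \<Rightarrow> 'k) \<Rightarrow>
    (nat \<Rightarrow> 'e) \<times> int \<Rightarrow> 'k" where
  "term_op (Gen g) \<phi> = gen_op g \<phi>"
| "term_op Zero \<phi> = (\<lambda>z. \<zero>)"
| "term_op (Neg t) \<phi> = (\<lambda>z. \<ominus> term_op t \<phi> z)"
| "term_op (Plus t u) \<phi> = (\<lambda>z. term_op t \<phi> z \<oplus> term_op u \<phi> z)"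
| "term_op (Times t u) \<phi> = term_op t (term_op u \<phi>)"
| "term_op (Scale c t) \<phi> = (\<lambda>z. c \<otimes> term_op t \<phi> z)"

abbreviation Funs :: "((nat \<Rightarrow> 'e) \<times> int \<Rightarrow> 'k) set" where
  "Funs \<equiv> UNIV \<rightarrow> carrier K"

lemma gen_op_closed: "\<phi> \<in> Funs \<Longrightarrow> gen_op g \<phi> \<in> Funs"
  by (cases g) (auto simp: Pi_iff)

lemma term_op_closed: "t \<in> T \<Longrightarrow> \<phi> \<in> Funs \<Longrightarrow> term_op t \<phi> \<in> Funs"
proof (induction t arbitrary: \<phi> rule: alg_terms.induct)
  case (1 x)
  then show ?case using gen_op_closed by simp
next
  case (5 t u)
  then show ?case by simp
qed (auto simp: Pi_iff)

lemma term_op_closed' [simp]: "t \<in> T \<Longrightarrow> \<phi> \<in> Funs \<Longrightarrow> term_op t \<phi> z \<in> carrier K"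
  using term_op_closed by blast

text \<open>As \<open>Times\<close> is interpreted by composition, the axiom
  \<open>Times_Plus\<close> becomes additivity of the operators. In the same way
  \<open>Scale_Times_right\<close> becomes their homogeneity, shown next.\<close>

lemma term_op_add:
  assumes "t \<in> T" "\<phi> \<in> Funs" "\<psi> \<in> Funs"
  shows "term_op t (\<lambda>z. \<phi> z \<oplus> \<psi> z) = (\<lambda>z. term_op t \<phi> z \<oplus> term_op t \<psi> z)"
  using assms
proof (induction t arbitrary: \<phi> \<psi> rule: alg_terms.induct)
  case (1 x)
  then show ?case by (cases x) (auto simp: Pi_iff fun_eq_iff)
next
  case (3 t)
  then show ?case by (auto simp: minus_add)
next
  case (4 t u)
  then show ?case by (auto simp: a_ac)
next
  case (5 t u)
  then show ?case using term_op_closed by simp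
next
  case (6 a t)
  then show ?case by (auto simp: r_distr)
qed (simp_all add: Pi_iff)

lemma term_op_smult:
  assumes "t \<in> T" "\<phi> \<in> Funs" "c \<in> carrier K"
  shows "term_op t (\<lambda>z. c \<otimes> \<phi> z) = (\<lambda>z. c \<otimes> term_op t \<phi> z)"
  using assms
proof (induction t arbitrary: \<phi> rule: alg_terms.induct)
  case (1 x)
  then show ?case by (cases x) (auto simp: Pi_iff fun_eq_iff)
next
  case (3 t)
  then show ?case by (auto simp: r_minus)
next
  case (4 t u)
  then show ?case by (auto simp: r_distr)
next
  case (5 t u)
  then show ?case using term_op_closed by simp
next
  case (6 a t)
  then show ?case by (auto simp: m_ac)
qed (simp_all add: Pi_iff)

lemma term_op_Sum_list:
  "term_op (Sum_list ts) \<phi> z = foldr (\<oplus>) (map (\<lambda>t. term_op t \<phi> z) ts) \<zero>"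
  by (induction ts) (auto simp: Sum_list_def)

lemma foldr_add_single:
  assumes "distinct es" "a \<in> carrier K"
  shows "foldr (\<oplus>) (map (\<lambda>e. if e = f then a else \<zero>) es) \<zero> = (if f \<in> set es then a else \<zero>)"
  using assms by (induction es) auto

lemma paths_shift: "y \<in> paths \<Longrightarrow> (\<lambda>i. y (Suc i)) \<in> paths"
  unfolding paths_def infinite_path_def using Q_closed by fastforce

lemma paths_arc: "y \<in> paths \<Longrightarrow> y i \<in> arcs E"
  by (simp add: paths_def infinite_path_def)

lemma paths_tail: "y \<in> paths \<Longrightarrow> tail E (y (Suc i)) = head E (y i)"
  by (simp add: paths_def infinite_path_def)

lemma paths_prepend:
  "y \<in> paths \<Longrightarrow> e \<in> arcs E \<Longrightarrow> tail E (y 0) = head E e \<Longrightarrow> case_nat e y \<in> paths"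
  unfolding paths_def infinite_path_def using Q_closed by (auto split: nat.split)

lemma case_nat_shift: "case_nat (y 0) (\<lambda>i. y (Suc i)) = y"
  by (auto simp: fun_eq_iff split: nat.split)

text \<open>The two degree shifts cancel, leaving the projection onto functions supported on paths
  that begin with \<open>e\<close>. These projections add up to the action of a vertex, as relation
  (iv) demands.\<close>

lemma edge_ghost_op:
  "e \<in> arcs E \<Longrightarrow> gen_op (Edge e) (gen_op (Ghost e) \<phi>) (y, n) =
    (if y \<in> paths \<and> y 0 = e then \<phi> (y, n) else \<zero>)"
  using case_nat_shift[of y] paths_shift[of y] by (auto simp: paths_tail)

lemma term_op_rel:
  assumes "(t, u) \<in> leavitt_rels E" "\<phi> \<in> Funs"
  shows "term_op t \<phi> = term_op u \<phi>"
  using assms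
proof (induction rule: leavitt_rels.induct)
  case (vertex_sum v es)
  have "term_op (Sum_list (map (\<lambda>e. Times (Gen (Edge e)) (Gen (Ghost e))) es)) \<phi> (y, n) =
      term_op (Gen (Vertex v)) \<phi> (y, n)" for y n
  proof -
    let ?a = "if y \<in> paths then \<phi> (y, n) else \<zero>"
    have arc: "e \<in> arcs E" if "e \<in> set es" for e using that vertex_sum by auto
    have "term_op (Sum_list (map (\<lambda>e. Times (Gen (Edge e)) (Gen (Ghost e))) es)) \<phi> (y, n) =
        foldr (\<oplus>) (map (\<lambda>e. gen_op (Edge e) (gen_op (Ghost e) \<phi>) (y, n)) es) \<zero>"
      by (simp add: term_op_Sum_list comp_def)
    also have "map (\<lambda>e. gen_op (Edge e) (gen_op (Ghost e) \<phi>) (y, n)) es =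
        map (\<lambda>e. if e = y 0 then ?a else \<zero>) es"
      by (rule map_cong) (auto simp: edge_ghost_op arc simp del: gen_op.simps)
    also have "foldr (\<oplus>) \<dots> \<zero> = (if y 0 \<in> set es then ?a else \<zero>)"
      using vertex_sum by (intro foldr_add_single) auto
    also have "\<dots> = term_op (Gen (Vertex v)) \<phi> (y, n)"
      using vertex_sum paths_arc[of y 0] by auto
    finally show ?thesis .
  qed
  then show ?case by (auto simp: fun_eq_iff simp del: term_op.simps)
qed (auto simp: fun_eq_iff paths_shift paths_prepend paths_tail paths_arc
    split: nat.split dest: paths_arc)

lemma term_op_alg_eq:
  assumes "alg_eq K (leavitt_gens E) (leavitt_rels E) t u" "\<phi> \<in> Funs"
  shows "term_op t \<phi> = term_op u \<phi>"
  using assms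
proof (induction arbitrary: \<phi> rule: alg_eq.induct)
  case (rel t u)
  then show ?case by (rule term_op_rel)
next
  case (trans t u v)
  then show ?case by metis
next
  case (Times_cong t t' u u')
  then show ?case using term_op_closed[of u' \<phi>] alg_eq_terms by fastforce
next
  case (Times_Plus t u v)
  then show ?case using term_op_closed by (simp add: term_op_add)
next
  case (Scale_Times_right a t u)
  then show ?case using term_op_closed by (simp add: term_op_smult)
qed (simp_all add: a_ac m_ac l_distr r_distr r_neg fun_eq_iff)

section \<open>The kernel of the representation\<close>

definition op_kernel :: "('k, ('v, 'e) leavitt_gen) alg_term set set" where
  "op_kernel = {cl t | t. t \<in> T \<and> (\<forall>\<phi>\<in>Funs. term_op t \<phi> = (\<lambda>z. \<zero>))}"

text \<open>Congruent terms act alike, so the choice of the representative does not matter.\<close>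

lemma cl_in_op_kernel_iff:
  "t \<in> T \<Longrightarrow> cl t \<in> op_kernel \<longleftrightarrow> (\<forall>\<phi>\<in>Funs. term_op t \<phi> = (\<lambda>z. \<zero>))"
  using cl_eq_iff term_op_alg_eq unfolding op_kernel_def by fastforce

lemma op_kernelE:
  assumes "a \<in> op_kernel"
  obtains t where "t \<in> T" "a = cl t" "\<forall>\<phi>\<in>Funs. term_op t \<phi> = (\<lambda>z. \<zero>)"
  using assms by (auto simp: op_kernel_def)

lemma term_op_zero: "t \<in> T \<Longrightarrow> term_op t (\<lambda>z. \<zero>) = (\<lambda>z. \<zero>)"
  using term_op_smult[of t "\<lambda>z. \<zero>" \<zero>] by auto

lemma op_kernel_ideal: "two_sided_ideal op_kernel A"
proof -
  interpret ab: abelian_group A by (rule abelian_group_A)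
  have sub: "op_kernel \<subseteq> carrier A" using cl_closed by (auto simp: op_kernel_def)
  have "subgroup op_kernel (add_monoid A)"
  proof (rule ab.add.subgroupI)
    show "op_kernel \<noteq> {}"
      using cl_in_op_kernel_iff[of Zero] alg_terms.intros by fastforce
  next
    fix a assume "a \<in> op_kernel"
    then obtain t where t: "t \<in> T" "a = cl t" "\<forall>\<phi>\<in>Funs. term_op t \<phi> = (\<lambda>z. \<zero>)"
      by (rule op_kernelE)
    then show "\<ominus>\<^bsub>A\<^esub> a \<in> op_kernel"
      by (simp add: cl_uminus cl_in_op_kernel_iff alg_terms.intros)
  next
    fix a b assume "a \<in> op_kernel" "b \<in> op_kernel"
    then show "a \<oplus>\<^bsub>A\<^esub> b \<in> op_kernel"
      by (elim op_kernelE) (simp add: cl_add cl_in_op_kernel_iff alg_terms.intros)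
  qed (use sub in auto)
  moreover have "a \<otimes>\<^bsub>A\<^esub> x \<in> op_kernel \<and> x \<otimes>\<^bsub>A\<^esub> a \<in> op_kernel" if "a \<in> op_kernel" "x \<in> carrier A" for a x
  proof -
    obtain u where u: "u \<in> T" "x = cl u" using \<open>x \<in> carrier A\<close> by (rule carrierE)
    obtain t where t: "t \<in> T" "a = cl t" "\<forall>\<phi>\<in>Funs. term_op t \<phi> = (\<lambda>z. \<zero>)"
      using \<open>a \<in> op_kernel\<close> by (rule op_kernelE)
    show ?thesis
      using t u term_op_closed[of u]
      by (simp add: cl_mult cl_in_op_kernel_iff alg_terms.intros term_op_zero)
  qed
  ultimately show ?thesis
    by (auto simp: two_sided_ideal_def right_ideal_def intro!: additive_subgroup.intro)
qed

lemma vertex_notin_op_kernel: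
  assumes "y \<in> paths"
  shows "cl (Gen (Vertex (tail E (y 0)))) \<notin> op_kernel"
proof -
  have "tail E (y 0) \<in> verts E" using paths_arc[OF assms] by simp
  moreover have "(\<lambda>z. \<one>) \<in> Funs" by auto
  moreover have "term_op (Gen (Vertex (tail E (y 0)))) (\<lambda>z. \<one>) (y, 0) \<noteq> \<zero>" using assms by simp
  ultimately show ?thesis using cl_in_op_kernel_iff vertex_term by (metis (no_types, lifting))
qed

lemma zero_in_op_kernel: "\<zero>\<^bsub>A\<^esub> \<in> op_kernel"
  by (auto simp: cl_zero cl_in_op_kernel_iff alg_terms.intros)

text \<open>A single path makes the kernel proper, since the vertex at which it starts acts
  nontrivially on the constant function \<open>\<one>\<close>.\<close>

lemma simple_imp_op_kernel_trivial:
  assumes "simple_ring A" "y \<in> paths"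
  shows "op_kernel = {\<zero>\<^bsub>A\<^esub>}"
proof -
  have "op_kernel \<noteq> carrier A"
    using vertex_notin_op_kernel[OF assms(2)] paths_arc[OF assms(2), of 0] cl_closed vertex_term
    by (metis tail_in_verts)
  then show ?thesis using assms op_kernel_ideal by (auto simp: simple_ring_def)
qed

end

lemma (in abelian_monoid) foldr_add_eq_finsum:
  assumes "distinct xs" "f \<in> set xs \<rightarrow> carrier G"
  shows "foldr (\<oplus>) (map f xs) \<zero> = (\<Oplus>x\<in>set xs. f x)"
  using assms
  by (induction xs) (auto simp: Pi_iff)

locale sinkless_leavitt = leavitt_presentation K E + fin_digraph E
  for K :: "('k, 'n) ring_scheme" (structure) and E :: "('v, 'e) pre_digraph" +
  assumes no_sink: "v \<in> verts E \<Longrightarrow> out_arcs E v \<noteq> {}"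
begin

lemma infinite_path_exists:
  assumes "v \<in> verts E"
  shows "\<exists>y. infinite_path E y \<and> tail E (y 0) = v"
proof -
  define step where "step v = (SOME e. e \<in> out_arcs E v)" for v
  have step: "step v \<in> arcs E" "tail E (step v) = v" if "v \<in> verts E" for v
    using no_sink[OF that] some_in_eq[of "out_arcs E v"] by (auto simp: step_def)
  define y where "y = rec_nat (step v) (\<lambda>_ e. step (head E e))"
  have "y i \<in> arcs E" for i
    by (induction i) (simp_all add: y_def step assms)
  then have "infinite_path E y" by (simp add: infinite_path_def y_def step)
  then show ?thesis using step assms by (auto simp: y_def intro!: exI[of _ y])
qed

text \<open>Read off from the representation on all infinite paths; without sinks, one of them
  starts at \<open>v\<close>.\<close>

lemma vertex_nonzero:
  assumes "v \<in> verts E"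
  shows "cl (Gen (Vertex v)) \<noteq> \<zero>\<^bsub>A\<^esub>"
proof -
  interpret P: path_representation K E UNIV 0 by unfold_locales simp
  obtain y where "infinite_path E y" "tail E (y 0) = v"
    using infinite_path_exists assms by blast
  then show ?thesis
    using P.vertex_notin_op_kernel[of y] P.zero_in_op_kernel by (auto simp: P.paths_def)
qed

text \<open>No path inside \<open>Q\<close> starts at \<open>w\<close>, so \<open>w\<close> acts as
  zero there and lies in the kernel. The vertex \<open>v\<close> keeps that kernel proper, and
  simplicity would then make \<open>w\<close> zero, which the representation on all paths
  refutes.\<close>

lemma not_simple_if_disconnected:
  assumes Q: "\<And>e. e \<in> arcs E \<Longrightarrow> tail E e \<in> Q \<longleftrightarrow> head E e \<in> Q"
    and v: "v \<in> verts E" "v \<in> Q" and w: "w \<in> verts E" "w \<notin> Q"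
  shows "\<not> simple_ring A"
proof
  assume simple: "simple_ring A"
  interpret P: path_representation K E Q 0 by unfold_locales (rule Q)
  obtain y where "infinite_path E y" "tail E (y 0) = v"
    using infinite_path_exists v by blast
  then have "y \<in> P.paths" using v by (simp add: P.paths_def)
  then have "P.op_kernel = {\<zero>\<^bsub>A\<^esub>}" using P.simple_imp_op_kernel_trivial simple by blast
  moreover have "cl (Gen (Vertex w)) \<in> P.op_kernel"
    using w vertex_term by (auto simp: P.cl_in_op_kernel_iff P.paths_def fun_eq_iff)
  ultimately show False using vertex_nonzero w by simp
qed

section \<open>Powers of the sum of all edges\<close>

definition edge_sum :: "('k, ('v, 'e) leavitt_gen) alg_term" where
  "edge_sum = Sum_list (map (\<lambda>e. Gen (Edge e)) (SOME es. distinct es \<and> set es = arcs E))"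

definition unit_term :: "('k, ('v, 'e) leavitt_gen) alg_term" where
  "unit_term = Sum_list (map (\<lambda>v. Gen (Vertex v)) (SOME vs. distinct vs \<and> set vs = verts E))"

lemma arcs_list:
  "distinct (SOME es. distinct es \<and> set es = arcs E)" "set (SOME es. distinct es \<and> set es = arcs E) = arcs E"
  using someI_ex[OF finite_distinct_list[OF finite_arcs]] by (auto simp: conj_commute)

lemma verts_list:
  "distinct (SOME es. distinct es \<and> set es = verts E)" "set (SOME es. distinct es \<and> set es = verts E) = verts E"
  using someI_ex[OF finite_distinct_list[OF finite_verts]] by (auto simp: conj_commute)

lemma edge_sum_term: "edge_sum \<in> T" and unit_term_term: "unit_term \<in> T"
  using arcs_list verts_list
  by (auto simp: edge_sum_def unit_term_def intro!: Sum_list_term edge_term vertex_term)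

primrec edge_power :: "nat \<Rightarrow> ('k, ('v, 'e) leavitt_gen) alg_term" where
  "edge_power 0 = unit_term"
| "edge_power (Suc n) = Times edge_sum (edge_power n)"

lemma edge_power_term: "edge_power n \<in> T"
  by (induction n) (auto intro: alg_terms.intros edge_sum_term unit_term_term)

end

context path_representation
begin

text \<open>At a path \<open>y\<close> only the summand \<open>y 0\<close> of the sum of all edges
  contributes. That sum therefore acts as the shift of paths, with the degree moved by
  \<open>d\<close>.\<close>

lemma edge_power_op:
  assumes "sinkless_leavitt K E" "\<phi> \<in> Funs"
  shows "term_op (sinkless_leavitt.edge_power E n) \<phi> (y, m) =
    (if y \<in> paths then \<phi> (\<lambda>i. y (i + n), m - int n * d) else \<zero>)"
proof -
  interpret sinkless_leavitt K E by fact
  show ?thesis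
  proof (induction n arbitrary: y m)
    case 0
    have "term_op unit_term \<phi> (y, m) =
        foldr (\<oplus>) (map (\<lambda>v. if v = tail E (y 0) then (if y \<in> paths then \<phi> (y, m) else \<zero>) else \<zero>)
          (SOME es. distinct es \<and> set es = verts E)) \<zero>"
      unfolding unit_term_def term_op_Sum_list
      by (intro arg_cong2[where f = "\<lambda>xs. foldr (\<oplus>) xs"] refl) auto
    also have "\<dots> = (if tail E (y 0) \<in> verts E then (if y \<in> paths then \<phi> (y, m) else \<zero>) else \<zero>)"
      using verts_list assms by (subst foldr_add_single) auto
    finally show ?case using paths_arc[of y 0] by auto
  next
    case (Suc n)
    let ?a = "if y \<in> paths then term_op (edge_power n) \<phi> (\<lambda>i. y (Suc i), m - d) else \<zero>"
    have a: "?a \<in> carrier K" using assms edge_power_term by auto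
    have "term_op (edge_power (Suc n)) \<phi> (y, m) =
        foldr (\<oplus>) (map (\<lambda>e. if e = y 0 then ?a else \<zero>)
          (SOME es. distinct es \<and> set es = arcs E)) \<zero>"
      unfolding edge_power.simps edge_sum_def term_op.simps term_op_Sum_list
      by (intro arg_cong2[where f = "\<lambda>xs. foldr (\<oplus>) xs"] refl) auto
    also have "\<dots> = (if y 0 \<in> arcs E then ?a else \<zero>)"
      using arcs_list a by (subst foldr_add_single) auto
    also have "\<dots> = (if y \<in> paths then \<phi> (\<lambda>i. y (i + Suc n), m - int (Suc n) * d) else \<zero>)"
      using paths_arc[of y 0] paths_shift[of y] by (auto simp: Suc algebra_simps)
    finally show ?case .
  qed
qed

end

context sinkless_leavitt
begin

text \<open>If all infinite paths have period \<open>N\<close>, then the power \<open>N\<close> of the sum of all edges and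
  the unit act in the same way when the degree is forgotten, but not otherwise.\<close>

lemma not_simple_if_periodic:
  assumes "0 < N" and per: "\<And>y. infinite_path E y \<Longrightarrow> (\<lambda>i. y (i + N)) = y" and "verts E \<noteq> {}"
  shows "\<not> simple_ring A"
proof
  assume simple: "simple_ring A"
  interpret P: path_representation K E UNIV 0 by unfold_locales simp
  interpret P1: path_representation K E UNIV 1 by unfold_locales simp
  obtain y where y: "infinite_path E y"
    using infinite_path_exists \<open>verts E \<noteq> {}\<close> by blast
  then have yP: "y \<in> P.paths" "y \<in> P1.paths" by (auto simp: P.paths_def P1.paths_def)
  let ?t = "Plus (edge_power N) (Neg (edge_power 0))"
  have t: "?t \<in> T" by (intro alg_terms.intros edge_power_term)
  have "P.term_op (edge_power N) \<phi> z = P.term_op (edge_power 0) \<phi> z" if "\<phi> \<in> P.Funs" for \<phi> z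
    using that per by (cases z) (simp add: P.edge_power_op[OF sinkless_leavitt_axioms] P.paths_def
        del: edge_power.simps)
  then have "P.term_op ?t \<phi> = (\<lambda>z. \<zero>)" if "\<phi> \<in> P.Funs" for \<phi>
    using that edge_power_term[of 0] by (auto simp: fun_eq_iff r_neg simp del: edge_power.simps)
  then have "cl ?t \<in> P.op_kernel" using t P.cl_in_op_kernel_iff by blast
  then have "cl ?t = cl Zero"
    using P.simple_imp_op_kernel_trivial[OF simple yP(1)] by (simp add: cl_zero)
  \<comment> \<open>Simplicity turns membership in the ungraded kernel into a consequence of the
    relations, which the graded representation has to respect as well.\<close>
  then have eq: "alg_eq K (leavitt_gens E) (leavitt_rels E) ?t Zero"
    using t cl_eq_iff alg_terms.intros by blast
  \<comment> \<open>A function supported in degree 0 separates the two terms: at degree 0 the unit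
    reads it in degree 0 and the power \<open>N\<close> in degree \<open>-N\<close>.\<close>
  define \<phi> :: "(nat \<Rightarrow> 'e) \<times> int \<Rightarrow> 'k" where "\<phi> = (\<lambda>(y, m). if m = 0 then \<one> else \<zero>)"
  have \<phi>: "\<phi> \<in> P1.Funs" by (auto simp: \<phi>_def)
  have "P1.term_op ?t \<phi> (y, 0) = \<ominus> \<one>"
    using \<open>0 < N\<close> yP P1.edge_power_op[OF sinkless_leavitt_axioms \<phi>]
    by (simp add: \<phi>_def del: edge_power.simps)
  moreover have "P1.term_op ?t \<phi> (y, 0) = \<zero>"
    using P1.term_op_alg_eq[OF eq \<phi>] by (metis P1.term_op.simps(2))
  moreover have "\<ominus> \<one> \<noteq> \<zero>" by (metis minus_minus minus_zero one_closed zero_not_one)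
  ultimately show False by simp
qed

text \<open>Established before \<open>ring A\<close> is known, since the unit is itself a sum over
  the vertices.\<close>

lemma finsum_mult:
  assumes "finite V" "f \<in> V \<rightarrow> carrier A" "x \<in> carrier A"
  shows "finsum A f V \<otimes>\<^bsub>A\<^esub> x = finsum A (\<lambda>v. f v \<otimes>\<^bsub>A\<^esub> x) V"
    and "x \<otimes>\<^bsub>A\<^esub> finsum A f V = finsum A (\<lambda>v. x \<otimes>\<^bsub>A\<^esub> f v) V"
proof -
  interpret ab: abelian_group A by (rule abelian_group_A)
  have "finsum A f V \<otimes>\<^bsub>A\<^esub> x = finsum A (\<lambda>v. f v \<otimes>\<^bsub>A\<^esub> x) V \<and>
    x \<otimes>\<^bsub>A\<^esub> finsum A f V = finsum A (\<lambda>v. x \<otimes>\<^bsub>A\<^esub> f v) V"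
    using assms
  proof (induction V)
    case empty
    then show ?case by (simp add: A_l_null A_r_null)
  next
    case (insert v V)
    then have "f v \<in> carrier A" "f \<in> V \<rightarrow> carrier A" "(\<lambda>v. f v \<otimes>\<^bsub>A\<^esub> x) \<in> V \<rightarrow> carrier A"
      "(\<lambda>v. x \<otimes>\<^bsub>A\<^esub> f v) \<in> V \<rightarrow> carrier A"
      by (auto intro: A_m_closed)
    then show ?case using insert by (simp add: A_l_distr A_r_distr A_m_closed)
  qed
  then show "finsum A f V \<otimes>\<^bsub>A\<^esub> x = finsum A (\<lambda>v. f v \<otimes>\<^bsub>A\<^esub> x) V"
    "x \<otimes>\<^bsub>A\<^esub> finsum A f V = finsum A (\<lambda>v. x \<otimes>\<^bsub>A\<^esub> f v) V" by auto
qed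

lemma cl_Sum_list:
  assumes "distinct xs" "\<And>x. x \<in> set xs \<Longrightarrow> f x \<in> T"
  shows "cl (Sum_list (map f xs)) = finsum A (\<lambda>x. cl (f x)) (set xs)"
proof -
  interpret ab: abelian_group A by (rule abelian_group_A)
  have "cl (Sum_list (map f xs)) = foldr (\<oplus>\<^bsub>A\<^esub>) (map (\<lambda>x. cl (f x)) xs) \<zero>\<^bsub>A\<^esub>"
    using cl_sum_list[of "map f xs"] assms by (auto simp: comp_def)
  then show ?thesis using assms cl_closed by (subst ab.foldr_add_eq_finsum[symmetric]) auto
qed

section \<open>The presented algebra as a Leavitt family\<close>

abbreviation "vtx v \<equiv> cl (Gen (Vertex v))"
abbreviation "edg e \<equiv> cl (Gen (Edge e))"
abbreviation "gho e \<equiv> cl (Gen (Ghost e))"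

lemma gen_closed:
  "v \<in> verts E \<Longrightarrow> vtx v \<in> carrier A"
  "e \<in> arcs E \<Longrightarrow> edg e \<in> carrier A"
  "e \<in> arcs E \<Longrightarrow> gho e \<in> carrier A"
  by (auto intro!: cl_closed vertex_term edge_term ghost_term)

lemma leavitt_relations:
  "v \<in> verts E \<Longrightarrow> vtx v \<otimes>\<^bsub>A\<^esub> vtx v = vtx v"
  "v \<in> verts E \<Longrightarrow> w \<in> verts E \<Longrightarrow> v \<noteq> w \<Longrightarrow> vtx v \<otimes>\<^bsub>A\<^esub> vtx w = \<zero>\<^bsub>A\<^esub>"
  "e \<in> arcs E \<Longrightarrow> vtx (tail E e) \<otimes>\<^bsub>A\<^esub> edg e = edg e"
  "e \<in> arcs E \<Longrightarrow> edg e \<otimes>\<^bsub>A\<^esub> vtx (head E e) = edg e"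
  "e \<in> arcs E \<Longrightarrow> vtx (head E e) \<otimes>\<^bsub>A\<^esub> gho e = gho e"
  "e \<in> arcs E \<Longrightarrow> gho e \<otimes>\<^bsub>A\<^esub> vtx (tail E e) = gho e"
  "e \<in> arcs E \<Longrightarrow> gho e \<otimes>\<^bsub>A\<^esub> edg e = vtx (head E e)"
  "e \<in> arcs E \<Longrightarrow> f \<in> arcs E \<Longrightarrow> e \<noteq> f \<Longrightarrow> gho e \<otimes>\<^bsub>A\<^esub> edg f = \<zero>\<^bsub>A\<^esub>"
  by (simp_all add: cl_mult cl_zero vertex_term edge_term ghost_term
      cl_eqI[OF alg_eq.rel] leavitt_rels.intros)

lemma vertex_sum_relation:
  assumes "v \<in> verts E"
  shows "vtx v = finsum A (\<lambda>e. edg e \<otimes>\<^bsub>A\<^esub> gho e) (out_arcs E v)"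
proof -
  interpret ab: abelian_group A by (rule abelian_group_A)
  have "finite (out_arcs E v)" by (simp add: out_arcs_def)
  then obtain es where es: "set es = out_arcs E v" "distinct es"
    using finite_distinct_list by blast
  then have "es \<noteq> []" using no_sink assms by fastforce
  then have "vtx v = cl (Sum_list (map (\<lambda>e. Times (Gen (Edge e)) (Gen (Ghost e))) es))"
    using assms es by (intro cl_eqI alg_eq.rel leavitt_rels.vertex_sum)
  also have "\<dots> = finsum A (\<lambda>e. cl (Times (Gen (Edge e)) (Gen (Ghost e)))) (set es)"
    using es by (intro cl_Sum_list) (auto intro!: alg_terms.intros(5) edge_term ghost_term)
  also have "\<dots> = finsum A (\<lambda>e. edg e \<otimes>\<^bsub>A\<^esub> gho e) (out_arcs E v)"
    using es by (intro ab.finsum_cong') (auto simp: cl_mult edge_term ghost_term intro!: A_m_closed gen_closed)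
  finally show ?thesis .
qed

lemma cl_unit_term: "cl unit_term = finsum A vtx (verts E)"
  using cl_Sum_list[OF verts_list(1), of "\<lambda>v. Gen (Vertex v)"] verts_list vertex_term
  by (simp add: unit_term_def)

text \<open>If one vertex fixes \<open>x\<close> on a side, then by orthogonality all others kill
  \<open>x\<close> on that side, so the sum of the vertices fixes it.\<close>

lemma unit_mult:
  assumes "v \<in> verts E" "x \<in> carrier A"
  shows "vtx v \<otimes>\<^bsub>A\<^esub> x = x \<Longrightarrow> cl unit_term \<otimes>\<^bsub>A\<^esub> x = x"
    and "x \<otimes>\<^bsub>A\<^esub> vtx v = x \<Longrightarrow> x \<otimes>\<^bsub>A\<^esub> cl unit_term = x"
proof -
  interpret ab: abelian_group A by (rule abelian_group_A)
  have vc: "vtx \<in> verts E \<rightarrow> carrier A" using gen_closed by auto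
  show "cl unit_term \<otimes>\<^bsub>A\<^esub> x = x" if l: "vtx v \<otimes>\<^bsub>A\<^esub> x = x"
  proof -
    have "vtx w \<otimes>\<^bsub>A\<^esub> x = (if v = w then x else \<zero>\<^bsub>A\<^esub>)" if "w \<in> verts E" for w
      using assms l that leavitt_relations(2)[of w v] A_m_assoc[of "vtx w" "vtx v" x] gen_closed(1) A_l_null
      by (metis (full_types))
    then have "finsum A (\<lambda>w. vtx w \<otimes>\<^bsub>A\<^esub> x) (verts E) = finsum A (\<lambda>w. if v = w then x else \<zero>\<^bsub>A\<^esub>) (verts E)"
      using assms by (intro ab.finsum_cong') auto
    also have "\<dots> = x" using assms ab.finsum_singleton[of v "verts E" "\<lambda>_. x"] by simp
    finally show ?thesis using assms vc by (simp add: cl_unit_term finsum_mult)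
  qed
  show "x \<otimes>\<^bsub>A\<^esub> cl unit_term = x" if r: "x \<otimes>\<^bsub>A\<^esub> vtx v = x"
  proof -
    have "x \<otimes>\<^bsub>A\<^esub> vtx w = (if v = w then x else \<zero>\<^bsub>A\<^esub>)" if "w \<in> verts E" for w
      using assms r that leavitt_relations(2)[of v w] A_m_assoc[of x "vtx v" "vtx w"] gen_closed(1) A_r_null
      by (metis (full_types))
    then have "finsum A (\<lambda>w. x \<otimes>\<^bsub>A\<^esub> vtx w) (verts E) = finsum A (\<lambda>w. if v = w then x else \<zero>\<^bsub>A\<^esub>) (verts E)"
      using assms by (intro ab.finsum_cong') auto
    also have "\<dots> = x" using assms ab.finsum_singleton[of v "verts E" "\<lambda>_. x"] by simp
    finally show ?thesis using assms vc by (simp add: cl_unit_term finsum_mult)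
  qed
qed

lemma unit_term_gen:
  assumes "x \<in> leavitt_gens E"
  shows "alg_eq K (leavitt_gens E) (leavitt_rels E) (Times unit_term (Gen x)) (Gen x)"
    and "alg_eq K (leavitt_gens E) (leavitt_rels E) (Times (Gen x) unit_term) (Gen x)"
proof -
  have x: "Gen x \<in> T" using assms by (rule alg_terms.intros(1))
  have "\<exists>v\<in>verts E. \<exists>w\<in>verts E. vtx v \<otimes>\<^bsub>A\<^esub> cl (Gen x) = cl (Gen x) \<and>
    cl (Gen x) \<otimes>\<^bsub>A\<^esub> vtx w = cl (Gen x)"
  proof (cases x)
    case (Vertex v)
    then have "v \<in> verts E" using assms by (auto simp: leavitt_gens_def)
    then show ?thesis using Vertex leavitt_relations(1) by (intro bexI[of _ v]) simp_all
  next
    case (Edge e)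
    then have "e \<in> arcs E" using assms by (auto simp: leavitt_gens_def)
    then show ?thesis using Edge leavitt_relations(3,4)
      by (intro bexI[of _ "tail E e"] bexI[of _ "head E e"]) simp_all
  next
    case (Ghost e)
    then have "e \<in> arcs E" using assms by (auto simp: leavitt_gens_def)
    then show ?thesis using Ghost leavitt_relations(5,6)
      by (intro bexI[of _ "head E e"] bexI[of _ "tail E e"]) simp_all
  qed
  then obtain v w where vw: "v \<in> verts E" "w \<in> verts E" "vtx v \<otimes>\<^bsub>A\<^esub> cl (Gen x) = cl (Gen x)"
    "cl (Gen x) \<otimes>\<^bsub>A\<^esub> vtx w = cl (Gen x)" by blast
  have "cl unit_term \<otimes>\<^bsub>A\<^esub> cl (Gen x) = cl (Gen x)"
    by (rule unit_mult(1)[OF vw(1) cl_closed[OF x] vw(3)])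
  then show "alg_eq K (leavitt_gens E) (leavitt_rels E) (Times unit_term (Gen x)) (Gen x)"
    by (simp add: cl_mult cl_eq_iff x unit_term_term alg_terms.intros(5))
  have "cl (Gen x) \<otimes>\<^bsub>A\<^esub> cl unit_term = cl (Gen x)"
    by (rule unit_mult(2)[OF vw(2) cl_closed[OF x] vw(4)])
  then show "alg_eq K (leavitt_gens E) (leavitt_rels E) (Times (Gen x) unit_term) (Gen x)"
    by (simp add: cl_mult cl_eq_iff x unit_term_term alg_terms.intros(5))
qed

lemma algebra_induct:
  assumes "a \<in> carrier A"
    and "\<And>v. v \<in> verts E \<Longrightarrow> P (vtx v)"
    and "\<And>e. e \<in> arcs E \<Longrightarrow> P (edg e)"
    and "\<And>e. e \<in> arcs E \<Longrightarrow> P (gho e)"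
    and "P \<zero>\<^bsub>A\<^esub>"
    and "\<And>x. x \<in> carrier A \<Longrightarrow> P x \<Longrightarrow> P (\<ominus>\<^bsub>A\<^esub> x)"
    and "\<And>x y. x \<in> carrier A \<Longrightarrow> y \<in> carrier A \<Longrightarrow> P x \<Longrightarrow> P y \<Longrightarrow> P (x \<oplus>\<^bsub>A\<^esub> y)"
    and "\<And>x y. x \<in> carrier A \<Longrightarrow> y \<in> carrier A \<Longrightarrow> P x \<Longrightarrow> P y \<Longrightarrow> P (x \<otimes>\<^bsub>A\<^esub> y)"
    and "\<And>c x. c \<in> carrier K \<Longrightarrow> x \<in> carrier A \<Longrightarrow> P x \<Longrightarrow> P (c \<odot>\<^bsub>A\<^esub> x)"
  shows "P a"
proof -
  obtain t where t: "t \<in> T" "a = cl t" using assms(1) by (rule carrierE)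
  have "P (cl t)"
    using t(1)
  proof (induction rule: alg_terms.induct)
    case (1 x)
    then show ?case using assms(2-4) by (auto simp: leavitt_gens_def)
  next
    case 2
    then show ?case using assms(5) by (simp add: cl_zero)
  next
    case (3 t)
    then show ?case using assms(6)[of "cl t"] by (simp add: cl_uminus cl_closed)
  next
    case (4 t u)
    then show ?case using assms(7)[of "cl t" "cl u"] by (simp add: cl_add cl_closed)
  next
    case (5 t u)
    then show ?case using assms(8)[of "cl t" "cl u"] by (simp add: cl_mult cl_closed)
  next
    case (6 c t)
    then show ?case using assms(9)[of c "cl t"] by (simp add: cl_smult cl_closed)
  qed
  then show ?thesis using t by simp
qed

lemma leavitt_family: "leavitt_family A K E vtx edg gho"
proof (intro leavitt_family.intro leavitt_family_axioms.intro)
  show "ring A" using ring_A unit_term_term unit_term_gen by blast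
  show "\<one>\<^bsub>A\<^esub> = finsum A vtx (verts E)"
    using ring_A(2) unit_term_term unit_term_gen cl_unit_term by metis
  show "vtx v = finsum A (\<lambda>e. edg e \<otimes>\<^bsub>A\<^esub> gho e) (out_arcs E v)" if "v \<in> verts E" for v
    using that by (rule vertex_sum_relation)
  fix P :: "('k, ('v, 'e) leavitt_gen) alg_term set \<Rightarrow> bool" and a
  show "P a" if "a \<in> carrier A"
    "\<And>v. v \<in> verts E \<Longrightarrow> P (vtx v)"
    "\<And>e. e \<in> arcs E \<Longrightarrow> P (edg e)"
    "\<And>e. e \<in> arcs E \<Longrightarrow> P (gho e)"
    "P \<zero>\<^bsub>A\<^esub>"
    "\<And>x. x \<in> carrier A \<Longrightarrow> P x \<Longrightarrow> P (\<ominus>\<^bsub>A\<^esub> x)"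
    "\<And>x y. x \<in> carrier A \<Longrightarrow> y \<in> carrier A \<Longrightarrow> P x \<Longrightarrow> P y \<Longrightarrow> P (x \<oplus>\<^bsub>A\<^esub> y)"
    "\<And>x y. x \<in> carrier A \<Longrightarrow> y \<in> carrier A \<Longrightarrow> P x \<Longrightarrow> P y \<Longrightarrow> P (x \<otimes>\<^bsub>A\<^esub> y)"
    "\<And>c x. c \<in> carrier K \<Longrightarrow> x \<in> carrier A \<Longrightarrow> P x \<Longrightarrow> P (c \<odot>\<^bsub>A\<^esub> x)"
    using algebra_induct[of a P] that by blast
qed (simp_all add: module_A field_axioms fin_digraph_axioms smult_mult_A gen_closed
    leavitt_relations vertex_nonzero)

lemma purely_infinite_simple_if_connected:
  assumes "\<And>v f. v \<in> verts E \<Longrightarrow> \<exists>e\<in>out_arcs E v. e \<noteq> f"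
    and "\<And>v w. v \<in> verts E \<Longrightarrow> w \<in> verts E \<Longrightarrow> (v, w) \<in> (arcs_ends E)\<^sup>*"
    and "verts E \<noteq> {}"
  shows "purely_infinite_simple A"
  using leavitt_family.purely_infinite_simple_if_connected[OF leavitt_family assms] .

end

section \<open>Hopf graphs\<close>

locale ramified_group = group G for G :: "('g, 'm) monoid_scheme" (structure) +
  fixes r :: "'g set \<Rightarrow> nat"
  assumes finite_carrier: "finite (carrier G)"
    and ramified: "\<exists>C\<in>conj_classes G. r C \<noteq> 0"
begin

abbreviation "\<Gamma> \<equiv> hopf_graph G r"

lemma conj_class_subset: "C \<in> conj_classes G \<Longrightarrow> C \<subseteq> carrier G"
  by (auto simp: conj_classes_def conj_class_def)

lemma conj_class_nonempty: "C \<in> conj_classes G \<Longrightarrow> C \<noteq> {}"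
  by (auto simp: conj_classes_def conj_class_def)

lemma finite_conj_classes: "finite (conj_classes G)"
  by (simp add: conj_classes_def finite_carrier)

lemma finite_conj_class: "C \<in> conj_classes G \<Longrightarrow> finite C"
  using conj_class_subset finite_carrier finite_subset by blast

lemma hopf_arcs:
  "arcs \<Gamma> = carrier G \<times> (SIGMA C:conj_classes G. C \<times> {..<r C})"
  by (auto simp: hopf_graph_def)

lemma fin_digraph_hopf: "fin_digraph \<Gamma>"
proof
  show "finite (arcs \<Gamma>)"
    unfolding hopf_arcs using finite_carrier finite_conj_classes finite_conj_class by auto
  show "finite (verts \<Gamma>)" by (simp add: hopf_graph_def finite_carrier)
  fix e assume "e \<in> arcs \<Gamma>"
  then show "tail \<Gamma> e \<in> verts \<Gamma>" "head \<Gamma> e \<in> verts \<Gamma>"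
    using conj_class_subset by (auto simp: hopf_graph_def)
qed

text \<open>An edge leaving \<open>x\<close> amounts to a class, an element of it and an index, a
  choice independent of \<open>x\<close>. This identifies the sum in the third statement as a common
  out-degree.\<close>

lemma card_out_arcs:
  assumes "x \<in> carrier G"
  shows "card (out_arcs \<Gamma> x) = (\<Sum>C\<in>conj_classes G. r C * card C)"
proof -
  have "out_arcs \<Gamma> x = Pair x ` (SIGMA C:conj_classes G. C \<times> {..<r C})"
    using assms by (auto simp: out_arcs_def hopf_graph_def)
  then have "card (out_arcs \<Gamma> x) = card (SIGMA C:conj_classes G. C \<times> {..<r C})"
    by (simp add: card_image inj_on_def)
  also have "\<dots> = (\<Sum>C\<in>conj_classes G. r C * card C)"
    using finite_conj_classes finite_conj_class
    by (subst card_SigmaI) (auto simp: card_cartesian_product mult.commute)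
  finally show ?thesis .
qed

lemma out_arcs_nonempty:
  assumes "x \<in> carrier G"
  obtains C c where "C \<in> conj_classes G" "c \<in> C" "0 < r C" "(x, C, c, 0) \<in> out_arcs \<Gamma> x"
proof -
  obtain C where "C \<in> conj_classes G" "0 < r C" using ramified by auto
  moreover from this obtain c where "c \<in> C" using conj_class_nonempty by auto
  ultimately show thesis using assms that by (auto simp: out_arcs_def hopf_graph_def)
qed

lemma ram_semigroup_subset: "ram_semigroup G r \<subseteq> carrier G"
proof
  fix x assume "x \<in> ram_semigroup G r"
  then show "x \<in> carrier G"
    unfolding ram_semigroup_def
    by (induction rule: subsemigroup_generated.induct)
      (use conj_class_subset in \<open>auto simp: ram_support_def\<close>)
qed

lemma order_pos: "0 < order G"
  using finite_carrier by (simp add: order_gt_0_iff_finite)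

lemma ram_semigroup_mult:
  "x \<in> ram_semigroup G r \<Longrightarrow> y \<in> ram_semigroup G r \<Longrightarrow> x \<otimes> y \<in> ram_semigroup G r"
  unfolding ram_semigroup_def by (rule subsemigroup_generated.mult)

lemma ram_semigroup_gen:
  "C \<in> conj_classes G \<Longrightarrow> 0 < r C \<Longrightarrow> c \<in> C \<Longrightarrow> c \<in> ram_semigroup G r"
  unfolding ram_semigroup_def ram_support_def by (rule subsemigroup_generated.incl) auto

text \<open>In a finite group the inverse of an element is one of its positive powers.\<close>

lemma ram_semigroup_cancel:
  assumes "x \<in> carrier G" "c \<in> ram_semigroup G r" "x \<otimes> c \<in> ram_semigroup G r"
  shows "x \<in> ram_semigroup G r"
proof -
  have c: "c \<in> carrier G" using assms ram_semigroup_subset by blast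
  obtain m where "order G = Suc m" using order_pos gr0_implies_Suc by blast
  \<comment> \<open>Doubling the order makes the exponent \<open>Suc k\<close> of the inverse
    positive even in the trivial group; only positive powers of \<open>c\<close> are known to lie in
    the semigroup.\<close>
  then obtain k where k: "2 * order G = Suc (Suc k)" by simp
  have "c [^] Suc n \<in> ram_semigroup G r" for n
  proof (induction n)
    case (Suc n)
    then show ?case using ram_semigroup_mult[OF Suc assms(2)] by simp
  qed (use c assms in simp)
  then have "(x \<otimes> c) \<otimes> c [^] Suc k \<in> ram_semigroup G r"
    using ram_semigroup_mult[OF assms(3)] by blast
  moreover have "c [^] (2 * order G) = \<one>"
    using c by (simp add: mult_2 pow_order_eq_1 flip: nat_pow_mult)
  then have "c \<otimes> c [^] Suc k = \<one>" using nat_pow_Suc2[OF c, of "Suc k"] by (simp only: k)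
  then have "(x \<otimes> c) \<otimes> c [^] Suc k = x" using assms(1) c by (simp only: m_assoc nat_pow_closed r_one)
  ultimately show ?thesis by simp
qed

text \<open>Each generator labels an edge at every vertex, so a product is realised by concatenating
  paths. The vertex \<open>x\<close> is arbitrary in the induction because the second path starts at
  \<open>x \<otimes> s\<close>.\<close>

lemma ram_semigroup_reachable:
  assumes "s \<in> ram_semigroup G r" "x \<in> carrier G"
  shows "(x, x \<otimes> s) \<in> (arcs_ends \<Gamma>)\<^sup>*"
  using assms unfolding ram_semigroup_def
proof (induction arbitrary: x rule: subsemigroup_generated.induct)
  case (incl c)
  then obtain C where "C \<in> conj_classes G" "0 < r C" "c \<in> C" by (auto simp: ram_support_def)
  then have "(x, C, c, 0) \<in> arcs \<Gamma>" using incl by (simp add: hopf_graph_def)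
  then have "(x, x \<otimes> c) \<in> arcs_ends \<Gamma>"
    unfolding arcs_ends_def arc_to_ends_def
    by (rule image_eqI[rotated]) (simp add: hopf_graph_def)
  then show ?case by blast
next
  case (mult s t)
  then have "s \<in> carrier G" "t \<in> carrier G"
    using ram_semigroup_subset by (auto simp: ram_semigroup_def)
  then show ?case using mult by (metis m_assoc m_closed rtrancl_trans)
qed

text \<open>With only one edge at each vertex, all edges carry the same label \<open>c\<close>. A
  path then runs through \<open>x\<close>, \<open>x c\<close>, \<open>x c c\<close> and so on, and
  \<open>c\<close> to the power \<open>order G\<close> is the identity.\<close>

lemma infinite_path_periodic:
  assumes "(\<Sum>C\<in>conj_classes G. r C * card C) < 2" and y: "infinite_path \<Gamma> y"
  shows "(\<lambda>i. y (i + order G)) = y"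
proof -
  interpret fin_digraph \<Gamma> by (rule fin_digraph_hopf)
  obtain C c where C: "C \<in> conj_classes G" "c \<in> C" "0 < r C"
    using out_arcs_nonempty one_closed by metis
  then have c: "c \<in> carrier G" using conj_class_subset by blast
  have unique: "e = (tail \<Gamma> e, C, c, 0)" if e: "e \<in> arcs \<Gamma>" for e
  proof -
    have t: "tail \<Gamma> e \<in> carrier G" using e by (auto simp: hopf_graph_def)
    have "finite (out_arcs \<Gamma> (tail \<Gamma> e))" by (simp add: out_arcs_def)
    moreover have "card (out_arcs \<Gamma> (tail \<Gamma> e)) \<le> Suc 0" using card_out_arcs[OF t] assms by simp
    moreover have "e \<in> out_arcs \<Gamma> (tail \<Gamma> e)" "(tail \<Gamma> e, C, c, 0) \<in> out_arcs \<Gamma> (tail \<Gamma> e)"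
      using e t C by (auto simp: hopf_graph_def)
    ultimately show ?thesis by (metis card_le_Suc0_iff_eq)
  qed
  have arc: "y i \<in> arcs \<Gamma>" for i using y by (simp add: infinite_path_def)
  define x where "x i = tail \<Gamma> (y i)" for i
  have x: "x i \<in> carrier G" for i using arc[of i] by (auto simp: x_def hopf_graph_def)
  have step: "x (Suc i) = x i \<otimes> c" for i
  proof -
    have "x (Suc i) = head \<Gamma> (y i)" using y by (simp add: infinite_path_def x_def)
    also have "\<dots> = head \<Gamma> (x i, C, c, 0)" using unique[OF arc] by (metis x_def)
    finally show ?thesis by (simp add: hopf_graph_def)
  qed
  have "x (i + n) = x i \<otimes> c [^] n" for i n
    by (induction n) (use x c step m_assoc in auto)
  then have "x (i + order G) = x i" for i using x c pow_order_eq_1 by simp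
  then have "y (i + order G) = y i" for i using unique[OF arc] by (metis x_def)
  then show ?thesis by auto
qed

end

theorem corollary3p6:
  fixes G :: "('g, 'm) monoid_scheme" and r :: "'g set \<Rightarrow> nat"
    and K :: "('k, 'n) ring_scheme"
  assumes "group G" and "finite (carrier G)"
    and "\<exists>C\<in>conj_classes G. r C \<noteq> 0"
    and "field K"
  shows
    "(purely_infinite_simple (leavitt_path_algebra K (hopf_graph G r)) \<longleftrightarrow>
      simple_ring (leavitt_path_algebra K (hopf_graph G r))) \<and>
     (simple_ring (leavitt_path_algebra K (hopf_graph G r)) \<longleftrightarrow>
      ram_semigroup G r = carrier G \<and> (\<Sum>C\<in>conj_classes G. r C * card C) \<ge> 2)"
proof -
  interpret R: ramified_group G r using assms by (simp add: ramified_group_def ramified_group_axioms_def)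
  let ?E = "hopf_graph G r"
  interpret E: fin_digraph ?E by (rule R.fin_digraph_hopf)
  have verts: "verts ?E = carrier G" by (simp add: hopf_graph_def)
  interpret L: sinkless_leavitt K ?E
  proof (intro sinkless_leavitt.intro sinkless_leavitt_axioms.intro leavitt_presentation.intro)
    show "out_arcs ?E v \<noteq> {}" if "v \<in> verts ?E" for v
      using that R.out_arcs_nonempty[of v] verts by (metis empty_iff)
  qed (use assms E.wf_digraph_axioms E.fin_digraph_axioms in auto)
  have A: "leavitt_path_algebra K ?E = L.A" by (simp add: leavitt_path_algebra_def)
  have "ram_semigroup G r = carrier G" if "simple_ring L.A"
  proof (rule ccontr)
    assume "ram_semigroup G r \<noteq> carrier G"
    then obtain w where w: "w \<in> carrier G" "w \<notin> ram_semigroup G r"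
      using R.ram_semigroup_subset by blast
    obtain C c where "C \<in> conj_classes G" "c \<in> C" "0 < r C"
      using R.out_arcs_nonempty R.one_closed by metis
    then have c: "c \<in> ram_semigroup G r" using R.ram_semigroup_gen by blast
    have "tail ?E e \<in> ram_semigroup G r \<longleftrightarrow> head ?E e \<in> ram_semigroup G r" if "e \<in> arcs ?E" for e
    proof -
      obtain x D b i where e: "e = (x, D, b, i)" by (cases e)
      with that have x: "x \<in> carrier G" "D \<in> conj_classes G" "b \<in> D" "0 < r D"
        by (auto simp: hopf_graph_def)
      \<comment> \<open>Forwards this is closure under products; backwards it is cancellation, where
        finiteness of the group enters.\<close>
      have "x \<in> ram_semigroup G r \<longleftrightarrow> x \<otimes>\<^bsub>G\<^esub> b \<in> ram_semigroup G r"
        using R.ram_semigroup_gen[OF x(2,4,3)] x(1) R.ram_semigroup_mult R.ram_semigroup_cancel by blast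
      then show ?thesis by (simp add: e hopf_graph_def)
    qed
    then show False
      using L.not_simple_if_disconnected[of "ram_semigroup G r" c w] c w verts that
        R.ram_semigroup_subset by auto
  qed
  moreover have "(\<Sum>C\<in>conj_classes G. r C * card C) \<ge> 2" if "simple_ring L.A"
  proof (rule ccontr)
    assume "\<not> ?thesis"
    then show False
      using L.not_simple_if_periodic[OF R.order_pos R.infinite_path_periodic] R.one_closed verts that
      by auto
  qed
  moreover have "purely_infinite_simple L.A"
    if S: "ram_semigroup G r = carrier G" and d: "(\<Sum>C\<in>conj_classes G. r C * card C) \<ge> 2"
  proof (rule L.purely_infinite_simple_if_connected)
    fix v f assume v: "v \<in> verts ?E"
    show "\<exists>e\<in>out_arcs ?E v. e \<noteq> f"
    proof (rule ccontr)
      assume "\<not> ?thesis"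
      then have "out_arcs ?E v \<subseteq> {f}" by auto
      then have "card (out_arcs ?E v) \<le> 1" using card_mono[of "{f}"] by simp
      then show False using R.card_out_arcs v verts d by simp
    qed
  next
    fix v w assume v: "v \<in> verts ?E" "w \<in> verts ?E"
    \<comment> \<open>The label that leads from \<open>v\<close> to \<open>w\<close> belongs to the
      semigroup because the semigroup is the whole group.\<close>
    then have "inv\<^bsub>G\<^esub> v \<otimes>\<^bsub>G\<^esub> w \<in> ram_semigroup G r" "v \<otimes>\<^bsub>G\<^esub> (inv\<^bsub>G\<^esub> v \<otimes>\<^bsub>G\<^esub> w) = w"
      using S verts by (auto simp flip: R.m_assoc)
    then show "(v, w) \<in> (arcs_ends ?E)\<^sup>*"
      using R.ram_semigroup_reachable v verts by metis
  qed (use verts R.one_closed in auto)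
  \<comment> \<open>The implications form a cycle: the first statement contains the second by
    definition, the second gives both parts of the third, and the third gives the first.\<close>
  ultimately show ?thesis unfolding A purely_infinite_simple_def by blast
qed

end
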